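(* Let $k\ge 0$ be an integer and let $X$ be a toric Fano $d$-fold with Picard number $\rho_X = 2d-k$. If $d > 15k^2+37k+1$, then $X$ is isomorphic to $(S_3)^m\times Y$, where $m$ is a positive integer and $Y$ is a toric Fano manifold of dimension at most $15k^2+37k+1$.
   Context: A toric Fano $d$-fold is a $d$-dimensional smooth projective toric variety whose anticanonical divisor is ample; a point is regarded as the $0$-dimensional toric Fano manifold. Isomorphism classes of toric Fano $d$-folds $X$ correspond one-to-one to lattice equivalence classes of $d$-dimensional smooth Fano polytopes $P$ (full-dimensional lattice polytopes with the origin in the interior such that the vertices of each facet form a lattice basis; the fan of $X$ consists of the cones over the faces of $P$), with $\rho_X = |\operatorname{Vert}(P)|-d$, and products of varieties correspond to direct sums $Q\oplus Q'=\operatorname{conv}(Q\times\{0\}\cup\{0\}\times Q')$ of polytopes. $S_3$ denotes the toric del Pezzo surface obtained by blowing up $\mathbb{P}^2$ in its three torus-invariant points; it corresponds to the hexagon with vertices $\pm e_1,\pm e_2,\pm(e_1-e_2)$. *)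

theory Defs
  imports "HOL-Analysis.Analysis"
begin

text \<open>
  A complete toric variety is represented by a pair \<open>(N, \<Sigma>)\<close>: the lattice \<open>N\<close> of one-parameter
  subgroups of its torus, sitting inside a Euclidean space that may be larger than
  \<open>N\<^sub>\<real> = span N\<close>, and the set \<open>\<Sigma>\<close> of all cones of its fan.  The dimension of the variety is the
  rank of \<open>N\<close>, so varieties of different dimensions can share one ambient type.
\<close>

type_synonym 'a toric = "'a set \<times> 'a set set"

definition lattice_basis :: "'a::euclidean_space set \<Rightarrow> 'a set \<Rightarrow> bool" where
  "lattice_basis N B \<longleftrightarrow>
     independent B \<and> N = {(\<Sum>b\<in>B. of_int (c b) *\<^sub>R b) | c :: 'a \<Rightarrow> int. True}"

definition vert :: "'a::euclidean_space set \<Rightarrow> 'a set" where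
  "vert P = {v. v extreme_point_of P}"

text \<open>
  Full-dimensionality in \<open>span N\<close> is the condition on the affine hull; together with it,
  \<open>0 \<in> rel_interior P\<close> says that the origin is interior to \<open>P\<close> within \<open>span N\<close>.
  For \<open>N = {0}\<close> the only such polytope is \<open>{0}\<close>.
\<close>

definition smooth_fano_polytope :: "'a::euclidean_space set \<Rightarrow> 'a set \<Rightarrow> bool" where
  "smooth_fano_polytope N P \<longleftrightarrow>
     (\<exists>B. lattice_basis N B) \<and>
     polytope P \<and> vert P \<subseteq> N \<and>
     affine hull P = span N \<and> 0 \<in> rel_interior P \<and>
     (\<forall>F. F facet_of P \<longrightarrow> lattice_basis N (vert F))"

text \<open>
  The library counts the empty set among the faces, and \<open>convex_cone hull {} = {0}\<close>, so the zero
  cone is included.  The improper face \<open>P\<close>, whose cone would be the whole space, is not.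
\<close>

definition face_fan :: "'a::euclidean_space set \<Rightarrow> 'a set set" where
  "face_fan P = {convex_cone hull F | F. F face_of P \<and> F \<noteq> P}"

definition toric_fano :: "nat \<Rightarrow> 'a::euclidean_space toric \<Rightarrow> bool" where
  "toric_fano d X \<longleftrightarrow>
     dim (fst X) = d \<and> (\<exists>P. smooth_fano_polytope (fst X) P \<and> snd X = face_fan P)"

text \<open>
  The number of rays minus the dimension.  For the face fan of a smooth Fano polytope the rays
  are the cones over the vertices.
\<close>

definition picard_number :: "'a::euclidean_space toric \<Rightarrow> int" where
  "picard_number X = int (card {\<sigma> \<in> snd X. dim \<sigma> = 1}) - int (dim (fst X))"

definition toric_iso :: "'a::euclidean_space toric \<Rightarrow> 'b::euclidean_space toric \<Rightarrow> bool" where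
  "toric_iso X Y \<longleftrightarrow>
     (\<exists>f. linear f \<and> inj_on f (span (fst X)) \<and>
          f ` fst X = fst Y \<and> (\<lambda>\<sigma>. f ` \<sigma>) ` snd X = snd Y)"

definition toric_prod :: "'a toric \<Rightarrow> 'b toric \<Rightarrow> ('a \<times> 'b) toric" where
  "toric_prod X Y = (fst X \<times> fst Y, {\<sigma> \<times> \<tau> | \<sigma> \<tau>. \<sigma> \<in> snd X \<and> \<tau> \<in> snd Y})"

text \<open>
  The product of copies of \<open>X\<close> indexed by \<open>J\<close>, that is, \<open>X\<^sup>m\<close> for \<open>m = card J\<close>.  It lives in
  \<open>'a ^ 'n\<close>, with zero in the coordinates outside \<open>J\<close>, because the exponent cannot be
  part of a type.
\<close>

definition toric_power :: "'n::finite set \<Rightarrow> 'a::zero toric \<Rightarrow> ('a ^ 'n) toric" where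
  "toric_power J X =
     ({x. \<forall>i. x $ i \<in> (if i \<in> J then fst X else {0})},
      {{x. \<forall>i. x $ i \<in> (if i \<in> J then \<sigma> i else {0})} | \<sigma>. \<forall>i\<in>J. \<sigma> i \<in> snd X})"

definition S3 :: "(real \<times> real) toric" where
  "S3 = (\<int> \<times> \<int>,
         face_fan (convex hull {(1, 0), (-1, 0), (0, 1), (0, -1), (1, -1), (-1, 1)}))"

end

(*
  The vertices x of the polytope are graded by their level with respect to a facet B, the sum of the
  coordinates of x in the lattice basis B. The level is 1 on B and a non-positive integer elsewhere.
  Choose B such that the sum of all vertices lies in the cone over B. With 3d - k vertices, all but
  O(k) of the possible d vertices at level 0 and d vertices at level -1 must then be present. A vertex
  at level 0 with a negative coordinate at v in B is the vertex of the facet adjacent to B across v.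
  This rigidity makes almost every v in B satisfy: -v and w - v are vertices for some w in B. The
  exceptional v number at most 2k + k^2, and the companion w of v is unique, so that the
  remaining vertices of B, up to a set R with at most 4k + 2k^2 elements, fall into pairs {v, w}
  spanning hexagons of vertices.

  Turning B through the hexagons gives, for each vertex x, a facet whose functional is at least 1 on
  every nonzero component of x in a hexagon plane. So the sum of the R-coordinates of x plus the number
  of hexagon planes in which x has a nonzero component is at most 1. Summing over all vertices, at most
  3 |R| hexagon planes are touched by vertices outside their hexagon. The others split off as factors
  S_3, leaving a polytope of dimension at most 7 |R| <= 14k^2 + 28k.
*)
theory Submission
  imports Defs
begin

section \<open>Lattice bases and coordinates\<close>

text \<open>Levels are bounded above by 1, but nothing bounds a single level from below. Placing the
  vertex sum in the cone over B makes the total of all levels nonnegative, and this total pays for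
  the vertices at level -2 or lower.

  The obstacle is that a vertex at level 0 may have several negative coordinates, and then the
  vertices at level -1 need not be of the form -v. The numbers of negative coordinates beyond the
  first add up to some r \<le> k over all of level 0. The number of vertices at level -1 attached to
  one such vertex is quadratic in its own excess, which is the source of the k^2 in 2k + k^2.
  Passing to R doubles the bound, because a good v is lost when its companion is exceptional.

  With |T| hexagons the dimension is d = |R| + 2|T|, so |V| \<le> 3|R| + 6|T|. Six touches of each
  hexagon plane come from its own vertices, which leaves at most 3|R| for foreign ones; hence |R| +
  2 * 3|R| = 7|R|. With |R| \<le> 4k + 2k^2 this is 14k^2 + 28k, below the bound of the
  theorem.\<close>

abbreviation coord :: "'a::euclidean_space set \<Rightarrow> 'a \<Rightarrow> 'a \<Rightarrow> real" where
  "coord B b x \<equiv> representation B x b"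

definition lev :: "'a::euclidean_space set \<Rightarrow> 'a \<Rightarrow> real" where
  "lev B x = (\<Sum>b\<in>B. coord B b x)"

lemma lattice_basisD:
  assumes "lattice_basis N B"
  shows "independent B" "finite B" "B \<subseteq> N" "N \<subseteq> span B" "span N = span B"
    "card B = dim N"
proof -
  show ind: "independent B" using assms by (simp add: lattice_basis_def)
  then show fin: "finite B" by (simp add: independent_imp_finite)
  have N: "N = {(\<Sum>b\<in>B. of_int (c b) *\<^sub>R b) | c :: 'a \<Rightarrow> int. True}"
    using assms by (simp add: lattice_basis_def)
  show sub: "B \<subseteq> N"
  proof
    fix b assume b: "b \<in> B"
    have "(\<Sum>x\<in>B. of_int (if x = b then 1 else 0) *\<^sub>R x) = b"
      using b fin by (simp add: if_distrib if_distribR sum.delta cong: if_cong)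
    then show "b \<in> N" unfolding N
      by (intro CollectI exI[of _ "\<lambda>x. if x = b then 1 else 0"]) simp
  qed
  show "N \<subseteq> span B" unfolding N by (blast intro: span_sum span_scale span_base)
  then show sp: "span N = span B" using span_mono[OF sub] span_minimal[of N "span B"] by auto
  have "dim N = dim B" using sp dim_span[of N] dim_span[of B] by simp
  then show "card B = dim N" using dim_eq_card_independent[OF ind] by simp
qed

lemma coord_sum:
  assumes "independent B" "x \<in> span B"
  shows "(\<Sum>b\<in>B. coord B b x *\<^sub>R b) = x"
  using assms by (simp add: real_vector.sum_representation_eq independent_imp_finite)

lemma coord_unique:
  assumes "independent B" "x = (\<Sum>b\<in>B. f b *\<^sub>R b)" "b \<in> B"
  shows "coord B b x = f b"
proof -
  have fin: "finite B" by (simp add: assms(1) independent_imp_finite)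
  have x: "x \<in> span B" unfolding assms(2) by (intro span_sum span_scale span_base)
  have "(\<Sum>b\<in>B. (coord B b x - f b) *\<^sub>R b) = 0"
    using coord_sum[OF assms(1) x] assms(2) by (simp add: scaleR_diff_left sum_subtractf)
  then have "coord B b x - f b = 0"
    using real_vector.independentD[OF assms(1) fin order.refl _ assms(3), of "\<lambda>b. coord B b x - f b"]
    by simp
  then show ?thesis by simp
qed

lemma coord_basis: "independent B \<Longrightarrow> b \<in> B \<Longrightarrow> coord B c b = (if b = c then 1 else 0)"
  by (auto simp: real_vector.representation_basis)

lemma linear_coord:
  assumes "independent B" "x \<in> span B" "linear g"
  shows "g x = (\<Sum>b\<in>B. coord B b x * g b)"
proof -
  have "g x = g (\<Sum>b\<in>B. coord B b x *\<^sub>R b)" using coord_sum assms by metis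
  also have "\<dots> = (\<Sum>b\<in>B. coord B b x * g b)"
    using assms(3) by (simp add: linear_sum linear_scale)
  finally show ?thesis .
qed

lemma linear_add_scale:
  fixes g h :: "'a::real_vector \<Rightarrow> real"
  assumes "linear g" "linear h"
  shows "linear (\<lambda>x. g x + t * h x)"
  using assms by (intro linearI) (simp_all add: linear_add linear_scale algebra_simps)

text \<open>\<open>representation\<close> is 0 off \<open>span B\<close>, so a combination of
  coordinates need not be linear on the whole space. This gives a linear functional that agrees with
  it on the span.\<close>

lemma coord_functional:
  assumes "independent B"
  obtains g :: "'a::euclidean_space \<Rightarrow> real"
  where "linear g" "\<And>x. x \<in> span B \<Longrightarrow> g x = (\<Sum>b\<in>B. coord B b x * f b)" "\<And>b. b \<in> B \<Longrightarrow> g b = f b"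
proof -
  obtain g where g: "linear g" "\<forall>x\<in>B. g x = f x"
    using linear_independent_extend[OF assms, of f] by blast
  show thesis
  proof (rule that[of g])
    fix x assume "x \<in> span B"
    then show "g x = (\<Sum>b\<in>B. coord B b x * f b)"
      using linear_coord[OF assms _ g(1)] g(2) by (auto intro: sum.cong)
  qed (use g in auto)
qed

lemma lev_eq_linear:
  assumes "independent B" "x \<in> span B" "linear g" "\<And>b. b \<in> B \<Longrightarrow> g b = 1"
  shows "lev B x = g x"
  using linear_coord[OF assms(1-3)] assms(4) by (simp add: lev_def)

lemma coord_int:
  assumes "lattice_basis N B" "x \<in> N"
  shows "coord B b x \<in> \<int>"
proof (cases "b \<in> B")
  case True
  obtain c :: "'a \<Rightarrow> int" where "x = (\<Sum>b\<in>B. of_int (c b) *\<^sub>R b)"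
    using assms by (auto simp: lattice_basis_def)
  then have "coord B b x = of_int (c b)"
    using coord_unique[OF lattice_basisD(1)[OF assms(1)] _ True] by auto
  then show ?thesis by simp
next
  case False
  then have "coord B b x = 0" using real_vector.representation_ne_zero[of B x b] by blast
  then show ?thesis by simp
qed

lemma lev_int:
  assumes "lattice_basis N B" "x \<in> N"
  shows "lev B x \<in> \<int>"
  unfolding lev_def by (intro Ints_sum coord_int[OF assms])

text \<open>The exchange step: solving the expansion of \<open>y\<close> for \<open>v\<close> and
  substituting into that of \<open>x\<close>. The level grows by \<open>1 - lev B y\<close> per unit
  of \<open>y\<close>, because \<open>y\<close> has level 1 in the new basis.\<close>

lemma coord_swap:
  assumes "independent B" "v \<in> B" "y \<in> span B" "coord B v y \<noteq> 0"
    and B': "B' = insert y (B - {v})" and ind: "independent B'"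
    and x: "x \<in> span B"
  shows "b \<in> B - {v} \<Longrightarrow> b \<noteq> y \<Longrightarrow>
      coord B' b x = coord B b x - coord B v x / coord B v y * coord B b y" (is "_ \<Longrightarrow> _ \<Longrightarrow> ?c")
    and "y \<notin> B - {v} \<Longrightarrow> coord B' y x = coord B v x / coord B v y"
    and "y \<notin> B - {v} \<Longrightarrow> lev B' x = lev B x + (1 - lev B y) * (coord B v x / coord B v y)"
proof -
  \<comment> \<open>The coefficient of \<open>y\<close> in the new expansion of \<open>x\<close>:
    the only one for which the \<open>v\<close>-parts cancel.\<close>
  define r where "r = coord B v x / coord B v y"
  have fin: "finite B" by (simp add: assms(1) independent_imp_finite)
  have split: "\<And>f::_\<Rightarrow>'b::comm_monoid_add. sum f B = f v + sum f (B - {v})"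
    using fin assms(2) by (simp add: sum.remove)
  have X: "y \<in> B - {v} \<Longrightarrow> coord B v y = 0"
    using coord_basis[OF assms(1), of y v] by auto
  have yn: "y \<notin> B - {v}" using X assms(4) by auto
  define f where "f = (\<lambda>b. if b = y then r else coord B b x - r * coord B b y)"
  have sx: "x = coord B v x *\<^sub>R v + (\<Sum>b\<in>B-{v}. coord B b x *\<^sub>R b)"
    using coord_sum[OF assms(1) x] by (simp add: split)
  have sy: "y = coord B v y *\<^sub>R v + (\<Sum>b\<in>B-{v}. coord B b y *\<^sub>R b)"
    using coord_sum[OF assms(1,3)] by (simp add: split)
  have ry: "r *\<^sub>R y = coord B v x *\<^sub>R v + (\<Sum>b\<in>B-{v}. (r * coord B b y) *\<^sub>R b)"
    using arg_cong[OF sy, of "\<lambda>z. r *\<^sub>R z"] assms(4)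
    by (simp add: r_def scaleR_add_right scaleR_sum_right)
  have "(\<Sum>b\<in>B'. f b *\<^sub>R b) = r *\<^sub>R y + (\<Sum>b\<in>B-{v}. f b *\<^sub>R b)"
    unfolding B' using yn fin by (simp add: f_def)
  also have "(\<Sum>b\<in>B-{v}. f b *\<^sub>R b) = (\<Sum>b\<in>B-{v}. coord B b x *\<^sub>R b - (r * coord B b y) *\<^sub>R b)"
    using yn by (intro sum.cong) (auto simp: f_def scaleR_diff_left)
  also have "r *\<^sub>R y + \<dots> = x"
    using sx ry by (simp add: sum_subtractf)
  finally have fx: "x = (\<Sum>b\<in>B'. f b *\<^sub>R b)" by simp
  have c: "coord B' b x = f b" if "b \<in> B'" for b
    using coord_unique[OF ind fx that] .
  show "?c" if "b \<in> B - {v}" "b \<noteq> y" using c[of b] that by (simp add: f_def r_def B')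
  show "coord B' y x = coord B v x / coord B v y" using c[of y] by (simp add: f_def r_def B')
  have "lev B' x = (\<Sum>b\<in>B'. f b)" unfolding lev_def using c by (intro sum.cong) auto
  also have "\<dots> = r + (\<Sum>b\<in>B-{v}. f b)" unfolding B' using yn fin by (simp add: f_def)
  also have "(\<Sum>b\<in>B-{v}. f b) = (\<Sum>b\<in>B-{v}. coord B b x - r * coord B b y)"
    using yn by (intro sum.cong) (auto simp: f_def)
  also have "\<dots> = (lev B x - coord B v x) - r * (lev B y - coord B v y)"
    by (simp add: sum_subtractf sum_distrib_left lev_def split)
  finally show "lev B' x = lev B x + (1 - lev B y) * (coord B v x / coord B v y)"
    using assms(4) by (simp add: r_def field_simps)
qed

section \<open>Vertex sets of smooth Fano polytopes\<close>

text \<open>Facets are encoded by the linear functionals with value 1 on them; the positivity condition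
  says that the origin is an interior point.\<close>

locale fano_vertices =
  fixes N V :: "'a::euclidean_space set"
  assumes finite_V: "finite V"
    and V_sub: "V \<subseteq> N"
    and zero_notin: "0 \<notin> V"
    and lattice: "\<exists>B. lattice_basis N B"
    and span_V: "N \<subseteq> span V"
    and interior: "\<And>g :: 'a \<Rightarrow> real. linear g \<Longrightarrow> \<forall>x\<in>V. g x \<le> 0 \<Longrightarrow> \<forall>x\<in>V. g x = 0"
    and smooth: "\<And>g :: 'a \<Rightarrow> real. linear g \<Longrightarrow> \<forall>x\<in>V. g x \<le> 1 \<Longrightarrow> V \<subseteq> span {x\<in>V. g x = 1} \<Longrightarrow>
      lattice_basis N {x\<in>V. g x = 1}"
begin

text \<open>A facet is stored as its vertex set. Integrality makes "below the supporting hyperplane"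
  read level at most 0 instead of less than 1.\<close>

definition facet :: "'a set \<Rightarrow> bool" where
  "facet B \<longleftrightarrow> B \<subseteq> V \<and> lattice_basis N B \<and> (\<forall>x\<in>V - B. lev B x \<le> 0)"

lemma span_eq: "span V = span N"
  using span_mono[OF V_sub] span_minimal[OF span_V subspace_span] by auto

lemma facetD:
  assumes "facet B"
  shows "independent B" "finite B" "B \<subseteq> V" "N \<subseteq> span B" "V \<subseteq> span B" "card B = dim N"
    "\<And>x. x \<in> V \<Longrightarrow> x \<notin> B \<Longrightarrow> lev B x \<le> 0" "lattice_basis N B"
  using assms lattice_basisD[of N B] V_sub by (auto simp: facet_def)

lemma lev_basis: "facet B \<Longrightarrow> b \<in> B \<Longrightarrow> lev B b = 1"
  using facetD(1,2)[of B] by (simp add: lev_def coord_basis)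

lemma lev_le_1: "facet B \<Longrightarrow> x \<in> V \<Longrightarrow> lev B x \<le> 1"
  using lev_basis facetD(7)[of B x] by (cases "x \<in> B") fastforce+

lemma lev_pos_iff: "facet B \<Longrightarrow> x \<in> V \<Longrightarrow> 0 < lev B x \<longleftrightarrow> x \<in> B"
  using lev_basis facetD(7)[of B x] by (cases "x \<in> B") fastforce+

lemma facet_coord_int: "facet B \<Longrightarrow> x \<in> V \<Longrightarrow> coord B b x \<in> \<int>"
  using coord_int facetD(8) V_sub by blast

lemma facet_lev_int: "facet B \<Longrightarrow> x \<in> V \<Longrightarrow> lev B x \<in> \<int>"
  using lev_int facetD(8) V_sub by blast

text \<open>On \<open>V\<close> the level with respect to the set where \<open>g\<close> is 1 is
  \<open>g\<close> itself; being an integer, a value below 1 is at most 0.\<close>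

lemma facet_functional:
  fixes g :: "'a \<Rightarrow> real"
  assumes "linear g" "\<forall>x\<in>V. g x \<le> 1" "V \<subseteq> span {x\<in>V. g x = 1}"
  shows "facet {x\<in>V. g x = 1}" (is "facet ?B")
proof -
  have lb: "lattice_basis N ?B" by (rule smooth[OF assms])
  have lev: "lev ?B x = g x" if "x \<in> V" for x
    using that assms(3) by (intro lev_eq_linear[OF lattice_basisD(1)[OF lb] _ assms(1)]) auto
  have "g x \<le> 0" if x: "x \<in> V" "g x \<noteq> 1" for x
  proof -
    have "g x \<in> \<int>" using lev_int[OF lb, of x] lev[OF x(1)] x(1) V_sub by auto
    then obtain n :: int where n: "g x = of_int n" by (elim Ints_cases)
    moreover have "g x \<le> 1" using x assms(2) by blast
    ultimately have "n \<le> 1" "n \<noteq> 1" using x(2) by simp_all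
    then show ?thesis using n by simp
  qed
  then have "\<forall>x\<in>V - ?B. lev ?B x \<le> 0" using lev by simp
  then show ?thesis unfolding facet_def using lb by blast
qed

text \<open>A ratio test: tilt \<open>g\<close> towards \<open>h\<close> until the first vertex with
  positive \<open>h\<close> reaches value 1. Such a vertex exists by
  \<open>interior\<close>.\<close>

lemma push_functional:
  fixes g h :: "'a \<Rightarrow> real"
  assumes g: "linear g" "\<forall>x\<in>V. g x \<le> 1" and h: "linear h"
    and le: "\<And>x. x \<in> V \<Longrightarrow> g x = 1 \<Longrightarrow> h x \<le> 0" and ex: "\<exists>x\<in>V. h x \<noteq> 0"
  obtains t x where "t \<ge> 0" "x \<in> V" "h x > 0" "g x + t * h x = 1" "\<forall>x\<in>V. g x + t * h x \<le> 1"
proof -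
  define P where "P = {x\<in>V. h x > 0}"
  have "P \<noteq> {}"
  proof (rule notI)
    assume "P = {}"
    then have "\<forall>x\<in>V. h x \<le> 0" by (auto simp: P_def not_less)
    with interior[OF h] ex show False by auto
  qed
  have fin: "finite P" using finite_V by (simp add: P_def)
  define q where "q = (\<lambda>x. (1 - g x) / h x)"
  define t where "t = Min (q ` P)"
  have "t \<in> q ` P" unfolding t_def using fin \<open>P \<noteq> {}\<close> by (intro Min_in) auto
  then obtain x where x: "x \<in> P" "t = q x" by blast
  have tle: "t \<le> q y" if "y \<in> P" for y using that fin by (simp add: t_def)
  have "t \<ge> 0" using x g(2) by (simp add: q_def P_def)
  show thesis
  proof (rule that[of t x])
    show "t \<ge> 0" by fact
    show "x \<in> V" "h x > 0" using x by (auto simp: P_def)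
    show "g x + t * h x = 1" using x by (simp add: P_def q_def)
    show "\<forall>y\<in>V. g y + t * h y \<le> 1"
    proof
      fix y assume y: "y \<in> V"
      show "g y + t * h y \<le> 1"
      proof (cases "h y > 0")
        case True
        then have "t \<le> (1 - g y) / h y" using tle[of y] y by (simp add: P_def q_def)
        then show ?thesis using True by (simp add: field_simps)
      next
        case False
        then have "t * h y \<le> 0" using \<open>t \<ge> 0\<close> by (simp add: mult_nonneg_nonpos)
        then show ?thesis using g(2) y by (smt (verit))
      qed
    qed
  qed
qed

text \<open>Among the functionals bounded by 1 on \<open>V\<close>, one with level-one set of
  maximal dimension has a spanning level-one set. Otherwise, tilting along a functional that
  vanishes on that set would add a vertex outside its span.\<close>

lemma facet_exists: "\<exists>B. facet B"
proof -
  let ?S = "\<lambda>g. {x\<in>V. (g::'a\<Rightarrow>real) x = 1}"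
  let ?P = "\<lambda>g :: 'a \<Rightarrow> real. linear g \<and> (\<forall>x\<in>V. g x \<le> 1)"
  have "?P (\<lambda>_. 0)" by (simp add: linear_zero)
  moreover have "\<forall>g. ?P g \<longrightarrow> dim (?S g) < Suc DIM('a)"
    using dim_subset_UNIV le_imp_less_Suc by blast
  ultimately have "\<exists>g. ?P g \<and> (\<forall>g'. ?P g' \<longrightarrow> dim (?S g') \<le> dim (?S g))"
    by (rule ex_has_greatest_nat)
  then obtain g where g: "?P g" and max: "\<And>g'. ?P g' \<Longrightarrow> dim (?S g') \<le> dim (?S g)"
    by (elim exE conjE) auto
  have "V \<subseteq> span (?S g)"
  proof (rule ccontr)
    assume "\<not> V \<subseteq> span (?S g)"
    then obtain v where v: "v \<in> V" "v \<notin> span (?S g)" by auto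
    obtain A where A: "A \<subseteq> ?S g" "independent A" "span A = span (?S g)"
    proof -
      obtain A where A: "A \<subseteq> ?S g" "independent A" "?S g \<subseteq> span A" by (rule basis_exists[of "?S g"])
      have "span A = span (?S g)"
        by (rule subset_antisym[OF span_mono[OF A(1)] span_minimal[OF A(3) subspace_span]])
      with A that show thesis by auto
    qed
    have ind: "independent (insert v A)" using A v by (simp add: independent_insert)
    obtain h :: "'a \<Rightarrow> real" where h: "linear h" "\<forall>x\<in>insert v A. h x = (if x = v then 1 else 0)"
      using linear_independent_extend[OF ind, of "\<lambda>x. if x = v then 1 else 0"] by blast
    have "v \<notin> A" using v(2) A(3) span_base[of v A] by metis
    then have hA: "h x = 0" if "x \<in> A" for x using h(2) that by auto
    have h0: "h x = 0" if "x \<in> ?S g" for x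
      using linear_eq_0_on_span[OF h(1) hA] A(3) span_base[OF that] by metis
    obtain t x where t: "t \<ge> 0" "x \<in> V" "h x > 0" "g x + t * h x = 1" "\<forall>x\<in>V. g x + t * h x \<le> 1"
    proof (rule push_functional[of g h])
      show "\<exists>x\<in>V. h x \<noteq> 0" using v(1) h(2) by (intro bexI[of _ v]) auto
      show "\<And>x. x \<in> V \<Longrightarrow> g x = 1 \<Longrightarrow> h x \<le> 0" using h0 by simp
      show "linear g" "\<forall>x\<in>V. g x \<le> 1" using g by blast+
    qed (rule h(1))
    define g' where "g' = (\<lambda>x. g x + t * h x)"
    have "linear g'" unfolding g'_def by (rule linear_add_scale) (use g h in auto)
    then have "?P g'" using t by (simp add: g'_def)
    have xn: "x \<notin> span (?S g)" 
    proof
      assume "x \<in> span (?S g)"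
      then have "h x = 0" using linear_eq_0_on_span[OF h(1), of "?S g" x] h0 by auto
      then show False using t(3) by simp
    qed
    have "insert x (?S g) \<subseteq> ?S g'" using h0 t by (auto simp: g'_def)
    then have "dim (insert x (?S g)) \<le> dim (?S g')" by (rule dim_subset)
    moreover have "dim (insert x (?S g)) = Suc (dim (?S g))" using xn by (simp add: dim_insert)
    ultimately show False using max[OF \<open>?P g'\<close>] by simp
  qed
  with facet_functional[of g] g have "facet (?S g)" by simp
  then show ?thesis ..
qed

text \<open>Integrality in both bases forces the coordinate to be -1, after which
  \<open>coord_swap\<close> loses its denominators.\<close>

lemma swap_facet:
  assumes B: "facet B" and v: "v \<in> B" and y: "y \<in> V" "coord B v y < 0" and B': "facet (insert y (B - {v}))"
  shows "coord B v y = -1" "y \<notin> B" "lev B y \<le> 0"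
    and "x \<in> V \<Longrightarrow> b \<in> B - {v} \<Longrightarrow>
      coord (insert y (B - {v})) b x = coord B b x + coord B v x * coord B b y"
    and "x \<in> V \<Longrightarrow> coord (insert y (B - {v})) y x = - coord B v x"
    and "x \<in> V \<Longrightarrow> lev (insert y (B - {v})) x = lev B x - (1 - lev B y) * coord B v x"
proof -
  note D = facetD[OF B] and D' = facetD[OF B']
  show yn: "y \<notin> B" using coord_basis[OF D(1), of y v] y by (auto split: if_splits)
  then show "lev B y \<le> 0" using D(7) y by auto
  have V: "x \<in> span B" if "x \<in> V" for x using D(5) that by auto
  note sw = coord_swap[OF D(1) v V[OF y(1)] _ refl D'(1) V]
  \<comment> \<open>The coordinate of \<open>v\<close> at \<open>y\<close> in the new basis is the
    inverse of that of \<open>y\<close> at \<open>v\<close> in the old one. Both are integers, so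
    they are units.\<close>
  have "coord (insert y (B - {v})) y v = 1 / coord B v y"
    using sw(2)[of v] y(2) yn v D(3) coord_basis[OF D(1) v] by auto
  moreover have "coord (insert y (B - {v})) y v \<in> \<int>" using facet_coord_int[OF B'] v D(3) by auto
  ultimately have "1 / coord B v y \<in> \<int>" "coord B v y \<in> \<int>" using facet_coord_int[OF B y(1)] by auto
  then obtain m n :: int where mn: "1 / coord B v y = of_int m" "coord B v y = of_int n"
    by (metis Ints_cases)
  have "real_of_int (m * n) = 1 / coord B v y * coord B v y" using mn by simp
  also have "\<dots> = of_int 1" using y(2) by simp
  finally have "m * n = 1" unfolding of_int_eq_iff .
  moreover have "n < 0" using mn y by simp
  ultimately have "n = -1" by (simp add: zmult_eq_1_iff)
  then show c: "coord B v y = -1" using mn by simp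
  show "coord (insert y (B - {v})) b x = coord B b x + coord B v x * coord B b y" if "x \<in> V" "b \<in> B - {v}"
    using sw(1)[of x b] that c yn by auto
  show "coord (insert y (B - {v})) y x = - coord B v x" if "x \<in> V"
    using sw(2)[of x] that c yn by auto
  show "lev (insert y (B - {v})) x = lev B x - (1 - lev B y) * coord B v x" if "x \<in> V"
    using sw(3)[of x] that c yn by auto
qed

text \<open>The functional of \<open>B\<close> is tilted by minus the coordinate at
  \<open>v\<close>: this keeps \<open>B - {v}\<close> at value 1 and lowers \<open>v\<close>, until
  a new vertex appears.\<close>

lemma neighbour_exists:
  assumes B: "facet B" and v: "v \<in> B"
  obtains y where "y \<in> V" "coord B v y < 0" "facet (insert y (B - {v}))"
proof -
  note D = facetD[OF B]
  obtain g :: "'a \<Rightarrow> real" where g: "linear g" "\<And>x. x \<in> span B \<Longrightarrow> g x = (\<Sum>b\<in>B. coord B b x * 1)"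
    "\<And>b. b \<in> B \<Longrightarrow> g b = 1" by (rule coord_functional[OF D(1), of "\<lambda>_. 1"]) blast
  obtain h :: "'a \<Rightarrow> real" where h: "linear h"
    "\<And>x. x \<in> span B \<Longrightarrow> h x = (\<Sum>b\<in>B. coord B b x * (if b = v then -1 else 0))"
    "\<And>b. b \<in> B \<Longrightarrow> h b = (if b = v then -1 else 0)"
    by (rule coord_functional[OF D(1), of "\<lambda>b. if b = v then -1 else 0"]) blast
  have gl: "g x = lev B x" if "x \<in> V" for x using g(2) that D(5) by (auto simp: lev_def)
  have hc: "h x = - coord B v x" if "x \<in> V" for x
  proof -
    have "h x = (\<Sum>b\<in>B. if b = v then - coord B v x else 0)"
      using that D(5) by (subst h(2)) (auto intro!: sum.cong)
    then show ?thesis using D(2) v by simp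
  qed
  have g1: "\<forall>x\<in>V. g x \<le> 1" using gl lev_le_1[OF B] by auto
  have h0: "h x \<le> 0" if "x \<in> V" "g x = 1" for x
    using h(3)[of x] that gl lev_pos_iff[OF B that(1)] by auto
  obtain t y where t: "t \<ge> 0" "y \<in> V" "h y > 0" "g y + t * h y = 1" "\<forall>x\<in>V. g x + t * h x \<le> 1"
  proof (rule push_functional[OF g(1) g1 h(1) h0])
    show "\<exists>x\<in>V. h x \<noteq> 0" using v D(3) h(3)[OF v] by (intro bexI[of _ v]) auto
  qed simp_all
  define g' where "g' = (\<lambda>x. g x + t * h x)"
  have lin: "linear g'" unfolding g'_def using g(1) h(1) by (rule linear_add_scale)
  have g': "\<forall>x\<in>V. g' x \<le> 1" using t by (simp add: g'_def)
  let ?S = "{x\<in>V. g' x = 1}"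
  let ?B = "insert y (B - {v})"
  have yc: "coord B v y < 0" using hc t by auto
  have yn: "y \<notin> B" using coord_basis[OF D(1), of y v] yc by (auto split: if_splits)
  have sub: "?B \<subseteq> ?S" using t g(3) h(3) D(3) by (auto simp: g'_def)
  have "v \<in> span ?B"
  proof -
    have y: "y \<in> span B" using t D by auto
    have "y = coord B v y *\<^sub>R v + (\<Sum>b\<in>B-{v}. coord B b y *\<^sub>R b)"
      using coord_sum[OF D(1) y] unfolding sum.remove[OF D(2) v] by simp
    then have "coord B v y *\<^sub>R v = y - (\<Sum>b\<in>B-{v}. coord B b y *\<^sub>R b)" by (simp add: algebra_simps)
    then have "(1 / coord B v y) *\<^sub>R (coord B v y *\<^sub>R v) = (1 / coord B v y) *\<^sub>R (y - (\<Sum>b\<in>B-{v}. coord B b y *\<^sub>R b))"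
      by simp
    then have v': "v = (1 / coord B v y) *\<^sub>R (y - (\<Sum>b\<in>B-{v}. coord B b y *\<^sub>R b))"
      using yc by simp
    have "(1 / coord B v y) *\<^sub>R (y - (\<Sum>b\<in>B-{v}. coord B b y *\<^sub>R b)) \<in> span ?B"
      by (intro span_scale span_diff span_sum span_base) auto
    then show ?thesis using v' by simp
  qed
  then have "B \<subseteq> span ?B" using span_base[of _ ?B] by fastforce
  then have "V \<subseteq> span ?B" using D(5) span_minimal[of B "span ?B"] by auto
  then have "V \<subseteq> span ?S" using span_mono[OF sub] by auto
  from facet_functional[OF lin g' this] have fS: "facet ?S" .
  \<comment> \<open>Every facet has \<open>dim N\<close> vertices, so the new level-one set contains
    nothing beyond the exchanged basis.\<close>
  have "card ?S = card B" using facetD(6)[OF fS] D(6) by simp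
  moreover have "card ?B = card B" using D(2) yn card.remove[OF D(2) v] by simp
  ultimately have "?B = ?S" using card_subset_eq[OF facetD(2)[OF fS] sub] by simp
  then show thesis using that[of y] fS t(2) yc by simp
qed

text \<open>Seen from the facet on the other side of v, such an x has positive level, so it must be the one
  vertex of that facet which is not in B.\<close>

lemma level_zero_swap:
  assumes B: "facet B" and v: "v \<in> B" and x: "x \<in> V" "lev B x = 0" "coord B v x < 0"
  shows "facet (insert x (B - {v}))" "coord B v x = -1"
    and "\<And>z. z \<in> V \<Longrightarrow> lev B z = 0 \<Longrightarrow> coord B v z < 0 \<Longrightarrow> z = x"
proof -
  obtain y where y: "y \<in> V" "coord B v y < 0" "facet (insert y (B - {v}))"
    using neighbour_exists[OF B v] .
  note sw = swap_facet[OF B v y]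
  have key: "z = y" if z: "z \<in> V" "lev B z = 0" "coord B v z < 0" for z
  proof -
    have "(1 - lev B y) * coord B v z < 0" using sw(3) z by (simp add: mult_pos_neg)
    then have "lev (insert y (B - {v})) z > 0" using sw(6)[OF z(1)] z(2) by simp
    then have "z \<in> insert y (B - {v})" using lev_pos_iff[OF y(3) z(1)] by simp
    moreover have "z \<notin> B" using lev_pos_iff[OF B z(1)] z(2) by simp
    ultimately show ?thesis by auto
  qed
  have "x = y" by (rule key[OF x])
  then show "facet (insert x (B - {v}))" "coord B v x = -1" using y sw by auto
  show "\<And>z. z \<in> V \<Longrightarrow> lev B z = 0 \<Longrightarrow> coord B v z < 0 \<Longrightarrow> z = x" using key \<open>x = y\<close> by auto
qed

text \<open>Take a facet on which the vertex sum has the largest level. If the sum had a negative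
  coordinate at \<open>b\<close>, its level with respect to the neighbour across \<open>b\<close>
  would be larger.\<close>

lemma facet_max_sum:
  obtains B where "facet B" "\<And>b. b \<in> B \<Longrightarrow> coord B b (\<Sum>x\<in>V. x) \<ge> 0"
proof -
  let ?s = "\<Sum>x\<in>V. x"
  have "finite {B. facet B}" using finite_V facetD(3) finite_subset[of "{B. facet B}" "Pow V"] by auto
  moreover have "{B. facet B} \<noteq> {}" using facet_exists by auto
  ultimately obtain B where B: "facet B" and max: "\<And>C. facet C \<Longrightarrow> lev C ?s \<le> lev B ?s"
  proof -
    assume F: "finite {B. facet B}" "{B. facet B} \<noteq> {}"
    let ?L = "(\<lambda>B. lev B ?s) ` {B. facet B}"
    have "Max ?L \<in> ?L" using F by (intro Max_in) auto
    then obtain B where B: "facet B" "Max ?L = lev B ?s" by auto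
    have "lev C ?s \<le> lev B ?s" if "facet C" for C
      using Max_ge[of ?L "lev C ?s"] F that B(2) by auto
    with B(1) that show thesis by blast
  qed
  note D = facetD[OF B]
  have s: "?s \<in> span B" using D(5) by (intro span_sum) auto
  show thesis
  proof (rule that[OF B], rule ccontr)
    fix b assume b: "b \<in> B" and neg: "\<not> coord B b ?s \<ge> 0"
    obtain y where y: "y \<in> V" "coord B b y < 0" "facet (insert y (B - {b}))"
      using neighbour_exists[OF B b] .
    note sw = swap_facet[OF B b y]
    have "lev (insert y (B - {b})) ?s = lev B ?s + (1 - lev B y) * (coord B b ?s / coord B b y)"
      using coord_swap(3)[OF D(1) b _ _ refl facetD(1)[OF y(3)] s] y D(5) sw(2) by auto
    moreover have "(1 - lev B y) * coord B b ?s < 0" using sw(3) neg by (simp add: mult_pos_neg)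
    ultimately have "lev (insert y (B - {b})) ?s > lev B ?s" using sw(1) by simp
    with max[OF y(3)] show False by simp
  qed
qed

end

lemma card_sum_ge_1:
  fixes f :: "'a \<Rightarrow> real"
  assumes "finite A" "\<And>a. a \<in> A \<Longrightarrow> f a \<ge> 1"
  shows "real (card A) \<le> sum f A"
  using sum_bounded_below[of A 1 f] assms by simp

lemma Ints_pos_ge_1: "x \<in> \<int> \<Longrightarrow> 0 < x \<Longrightarrow> (1::real) \<le> x"
  by (metis Ints_cases of_int_0_less_iff of_int_1_le_iff zless_imp_add1_zle add_0)

lemma Ints_neg_le_m1: "x \<in> \<int> \<Longrightarrow> x < 0 \<Longrightarrow> x \<le> (-1::real)"
  using Ints_pos_ge_1[of "-x"] by simp

section \<open>Vertices at levels 0 and -1 of a facet\<close>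

locale fano_facet = fano_vertices +
  fixes B
  assumes facet_B: "facet B"
begin

definition V0 where "V0 = {x\<in>V. lev B x = 0}"
definition V1 where "V1 = {x\<in>V. lev B x = -1}"
definition negs where "negs x = {v\<in>B. coord B v x < 0}"
text \<open>By \<open>level_zero_swap\<close>, these are the \<open>v\<close> for which the new
  vertex of the facet across \<open>v\<close> lies at level 0.\<close>

definition D0 where "D0 = (\<Union>y\<in>V0. negs y)"

lemmas B = facetD[OF facet_B]

lemma finite_simps [simp]: "finite B" "finite V0" "finite V1" "finite (negs x)" "finite D0"
  using B(2) finite_V by (auto simp: V0_def V1_def negs_def D0_def)

lemma negs_sub: "negs x \<subseteq> B" by (auto simp: negs_def)

lemma D0_sub: "D0 \<subseteq> B" by (auto simp: negs_def D0_def)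

lemma nonzero_coord:
  assumes "facet F" "x \<in> V"
  shows "\<exists>u\<in>F. coord F u x \<noteq> 0"
proof (rule ccontr)
  assume a: "\<not> ?thesis"
  have "x = (\<Sum>b\<in>F. coord F b x *\<^sub>R b)" 
    using facetD(1,5)[OF assms(1)] assms(2) by (intro coord_sum[symmetric]) auto
  also have "\<dots> = 0" using a by (intro sum.neutral) auto
  finally show False using zero_notin assms(2) by simp
qed

text \<open>If all coordinates were nonnegative, the level would be at least any one of them, hence
  positive.\<close>

lemma neg_coord_exists:
  assumes F: "facet F" and x: "x \<in> V" "x \<notin> F"
  shows "\<exists>u\<in>F. coord F u x < 0"
proof (rule ccontr)
  assume "\<not> ?thesis"
  then have nn: "\<forall>u\<in>F. coord F u x \<ge> 0" by (simp add: not_less)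
  obtain u where u: "u \<in> F" "coord F u x \<noteq> 0" using nonzero_coord[OF F x(1)] by blast
  have "coord F u x \<le> lev F x" unfolding lev_def
    using nn facetD(2)[OF F] u by (intro member_le_sum) auto
  moreover have "coord F u x > 0" using nn u by force
  ultimately show False using facetD(7)[OF F x] by simp
qed

lemma V0D: "y \<in> V0 \<Longrightarrow> y \<in> V \<and> y \<notin> B \<and> lev B y = 0"
  using lev_basis[OF facet_B] by (auto simp: V0_def)

lemma V1D: "x \<in> V1 \<Longrightarrow> x \<in> V \<and> x \<notin> B \<and> x \<notin> V0 \<and> lev B x = -1"
  using lev_basis[OF facet_B] by (auto simp: V1_def V0_def)

lemma coord_neg_le: "x \<in> V \<Longrightarrow> v \<in> negs x \<Longrightarrow> coord B v x \<le> -1"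
  using Ints_neg_le_m1 facet_coord_int[OF facet_B] by (auto simp: negs_def)

lemma coord_nonneg: "v \<in> B \<Longrightarrow> v \<notin> negs x \<Longrightarrow> coord B v x \<ge> 0"
  by (auto simp: negs_def)

lemma V0_swap:
  assumes y: "y \<in> V0" "v \<in> negs y"
  shows "facet (insert y (B - {v}))" "coord B v y = -1"
    and "\<And>z. z \<in> V0 \<Longrightarrow> v \<in> negs z \<Longrightarrow> z = y"
    and "\<And>x. x \<in> V \<Longrightarrow> lev (insert y (B - {v})) x = lev B x - coord B v x"
    and "\<And>x. x \<in> V \<Longrightarrow> coord (insert y (B - {v})) y x = - coord B v x"
    and "\<And>x b. x \<in> V \<Longrightarrow> b \<in> B - {v} \<Longrightarrow>
      coord (insert y (B - {v})) b x = coord B b x + coord B v x * coord B b y"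
proof -
  have v: "v \<in> B" "coord B v y < 0" using y by (auto simp: negs_def)
  have yV: "y \<in> V" "lev B y = 0" using y V0D by auto
  note L = level_zero_swap[OF facet_B v(1) yV v(2)]
  show f: "facet (insert y (B - {v}))" "coord B v y = -1" by (fact L(1) L(2))+
  note S = swap_facet[OF facet_B v(1) yV(1) v(2) f(1)]
  show "z = y" if "z \<in> V0" "v \<in> negs z" for z
    using L(3)[of z] that by (auto simp: V0_def negs_def)
  show "lev (insert y (B - {v})) x = lev B x - coord B v x" if "x \<in> V" for x
    using S(6)[OF that] yV by simp
  show "coord (insert y (B - {v})) y x = - coord B v x" if "x \<in> V" for x
    using S(5)[OF that] .
  show "coord (insert y (B - {v})) b x = coord B b x + coord B v x * coord B b y"
    if "x \<in> V" "b \<in> B - {v}" for x b using S(4)[OF that] .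
qed

lemma negs_nonempty: "x \<in> V \<Longrightarrow> x \<notin> B \<Longrightarrow> negs x \<noteq> {}"
  using neg_coord_exists[OF facet_B] by (auto simp: negs_def)

text \<open>Only one vertex at level 0 can be negative at a given \<open>v\<close>, so the sets
  \<open>negs y\<close> are disjoint.\<close>

lemma card_D0: "card D0 = (\<Sum>y\<in>V0. card (negs y))"
  unfolding D0_def
proof (rule card_UN_disjoint)
  show "\<forall>i\<in>V0. \<forall>j\<in>V0. i \<noteq> j \<longrightarrow> negs i \<inter> negs j = {}" using V0_swap(3) by blast
qed auto

text \<open>With a coordinate of -2 or less, crossing \<open>v\<close> would lift \<open>x\<close>
  from level -1 to a positive level and make it a vertex of the neighbouring facet, whose only new
  vertex is \<open>y\<close>.\<close>

lemma V1_coord: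
  assumes x: "x \<in> V1" "v \<in> negs x" and y: "y \<in> V0" "v \<in> negs y"
  shows "coord B v x = -1"
proof (rule ccontr)
  assume n: "coord B v x \<noteq> -1"
  have xV: "x \<in> V" "x \<notin> B" "lev B x = -1" using V1D x by auto
  have "coord B v x < -1" using coord_neg_le[OF xV(1) x(2)] n by simp
  then have "0 < lev (insert y (B - {v})) x" using V0_swap(4)[OF y xV(1)] xV by simp
  then have "x \<in> insert y (B - {v})" using lev_pos_iff[OF V0_swap(1)[OF y] xV(1)] by simp
  then show False using xV V0D y by auto
qed

lemma V1_swap_level: "x \<in> V1 \<Longrightarrow> v \<in> negs x \<Longrightarrow> y \<in> V0 \<Longrightarrow> v \<in> negs y \<Longrightarrow> lev (insert y (B - {v})) x = 0"
  using V0_swap(4) V1_coord V1D by simp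

text \<open>Suppose \<open>y1\<close> and \<open>y2\<close> differ. After crossing
  \<open>v1\<close>, both \<open>x\<close> and \<open>y2\<close> are at level 0 and negative at
  \<open>v2\<close>. The uniqueness in \<open>level_zero_swap\<close>, applied to that facet,
  identifies them, although their levels over \<open>B\<close> are -1 and 0.\<close>

lemma V1_negs_same:
  assumes x: "x \<in> V1" and v1: "v1 \<in> negs x" "y1 \<in> V0" "v1 \<in> negs y1"
    and v2: "v2 \<in> negs x" "y2 \<in> V0" "v2 \<in> negs y2"
  shows "y1 = y2"
proof (rule ccontr)
  assume ne: "y1 \<noteq> y2"
  have xV: "x \<in> V" using V1D x by auto
  \<comment> \<open>In the facet across \<open>u\<close> the coordinate of \<open>x\<close> at
    \<open>v\<close> is -1 minus a nonnegative number. At level 0 a negative coordinate is exactly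
    -1, so that number vanishes. Stated for general vertices so that it can be used in both
    directions.\<close>
  have key: "coord B v y = 0 \<and> coord (insert y (B - {u})) v x = -1"
    if h: "u \<in> negs x" "y \<in> V0" "u \<in> negs y" "v \<in> negs x" "z \<in> V0" "v \<in> negs z" "y \<noteq> z" for u v y z
  proof -
    have vB: "v \<in> B - {u}" using h V0_swap(3) by (auto simp: negs_def)
    have "v \<notin> negs y" using V0_swap(3) h by blast
    then have nn: "coord B v y \<ge> 0" using vB coord_nonneg by auto
    have c: "coord (insert y (B - {u})) v x = -1 - coord B v y"
      using V0_swap(6)[OF h(2,3) xV vB] V1_coord[OF x] h by simp
    then have "coord (insert y (B - {u})) v x < 0" using nn by simp
    then have "coord (insert y (B - {u})) v x = -1"
      using level_zero_swap(2)[OF V0_swap(1)[OF h(2,3)] _ xV V1_swap_level[OF x h(1-3)]] vB by simp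
    then show ?thesis using c by simp
  qed
  have k1: "coord B v2 y1 = 0 \<and> coord (insert y1 (B - {v1})) v2 x = -1"
    using key[OF v1 v2 ne] .
  have k2: "coord B v1 y2 = 0" using key[OF v2 v1] ne by simp
  have y2V: "y2 \<in> V" "lev B y2 = 0" using V0D v2 by auto
  have v2B: "v2 \<in> B - {v1}" using v1 v2 ne V0_swap(3) by (auto simp: negs_def)
  have "lev (insert y1 (B - {v1})) y2 = 0" using V0_swap(4)[OF v1(2,3) y2V(1)] k2 y2V by simp
  moreover have "coord (insert y1 (B - {v1})) v2 y2 < 0"
    using V0_swap(6)[OF v1(2,3) y2V(1) v2B] k2 V0_swap(2)[OF v2(2,3)] by simp
  ultimately have "y2 = x"
    using level_zero_swap(3)[OF V0_swap(1)[OF v1(2,3)] _ xV V1_swap_level[OF x v1], of v2 y2] k1 v2B y2V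
    by simp
  then show False using V1D x v2 by auto
qed

text \<open>Here the neighbour across \<open>z\<close> has level at most -1, so crossing lifts each
  of these vertices by at least 2, to positive level. Each is therefore the new vertex of that
  facet.\<close>

lemma V1_outside_unique:
  assumes z: "z \<in> B - D0" and x: "x1 \<in> V1" "z \<in> negs x1" "x2 \<in> V1" "z \<in> negs x2"
  shows "x1 = x2"
proof -
  obtain y where y: "y \<in> V" "coord B z y < 0" "facet (insert y (B - {z}))"
    using neighbour_exists[OF facet_B, of z] z by auto
  note S = swap_facet[OF facet_B _ y]
  have "lev B y \<noteq> 0" using y z by (auto simp: D0_def V0_def negs_def)
  then have le: "lev B y \<le> -1" using S(3) z Ints_neg_le_m1[OF facet_lev_int[OF facet_B y(1)]] by auto
  have "x = y" if h: "x \<in> V1" "z \<in> negs x" for x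
  proof -
    have xV: "x \<in> V" "lev B x = -1" "x \<notin> B" using V1D h by auto
    have "(1 - lev B y) * (- coord B z x) \<ge> 2 * 1"
      using le coord_neg_le[OF xV(1) h(2)] by (intro mult_mono) auto
    then have "lev (insert y (B - {z})) x > 0" using S(6)[of x] z xV by simp
    then show ?thesis using lev_pos_iff[OF y(3) xV(1)] xV by auto
  qed
  then show ?thesis using x by blast
qed

text \<open>The coordinates add up to 0, the negative ones are all -1, and the positive ones are
  integers.\<close>

lemma card_pos_le:
  assumes y: "y \<in> V0"
  shows "card {u\<in>B. coord B u y > 0} \<le> card (negs y)"
proof -
  let ?P = "{u\<in>B. coord B u y > 0}"
  have yV: "y \<in> V" "lev B y = 0" using V0D y by auto
  have "(\<Sum>b\<in>B. coord B b y) = (\<Sum>b\<in>?P \<union> negs y. coord B b y)"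
    by (rule sum.mono_neutral_right) (auto simp: negs_def not_less less_eq_real_def)
  also have "\<dots> = (\<Sum>b\<in>?P. coord B b y) + (\<Sum>b\<in>negs y. coord B b y)"
    by (rule sum.union_disjoint) (auto simp: negs_def)
  also have "(\<Sum>b\<in>negs y. coord B b y) = (\<Sum>b\<in>negs y. -1)"
    using V0_swap(2)[OF y] by (intro sum.cong) auto
  finally have "(\<Sum>b\<in>?P. coord B b y) = real (card (negs y))" using yV by (simp add: lev_def)
  moreover have "real (card ?P) \<le> (\<Sum>b\<in>?P. coord B b y)"
    using facet_coord_int[OF facet_B yV(1)] Ints_pos_ge_1 by (intro card_sum_ge_1) auto
  ultimately show ?thesis by simp
qed

section \<open>Vertices at level -1 attached to one vertex at level 0\<close>

definition X where "X y = {x\<in>V1. negs x \<subseteq> negs y}"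

lemma finite_X [simp]: "finite (X y)" by (simp add: X_def)

text \<open>After crossing \<open>z\<close>, the vertices counted are at level 0, so each is
  determined by any coordinate \<open>u\<close> at which it is negative. The candidates for
  \<open>u\<close> are the coordinates at which \<open>y\<close> is positive over \<open>B\<close>,
  and \<open>card_pos_le\<close> bounds their number.\<close>

lemma card_X_through:
  assumes y: "y \<in> V0" and z: "z \<in> negs y"
  shows "card {x\<in>X y. z \<in> negs x} \<le> card (negs y)"
proof -
  let ?B = "insert y (B - {z})" and ?P = "{u\<in>B. coord B u y > 0}"
  note F = V0_swap(1)[OF y z]
  have yV: "y \<notin> B" "y \<in> V" using V0D y by auto
  have "card {x\<in>X y. z \<in> negs x} \<le> card ?P"
  proof (rule card_le_if_inj_on_rel[where r = "\<lambda>x u. u \<in> B - {z} \<and> coord ?B u x < 0"])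
    fix x assume "x \<in> {x\<in>X y. z \<in> negs x}"
    then have x: "x \<in> V1" "z \<in> negs x" "negs x \<subseteq> negs y" by (auto simp: X_def)
    then have xV: "x \<in> V" using V1D by auto
    have l0: "lev ?B x = 0" by (rule V1_swap_level[OF x(1,2) y z])
    then have "x \<notin> ?B" using lev_pos_iff[OF F xV] by simp
    then obtain u where u: "u \<in> ?B" "coord ?B u x < 0" using neg_coord_exists[OF F xV] by blast
    have "coord ?B y x = 1" using V0_swap(5)[OF y z xV] V1_coord[OF x(1,2) y z] by simp
    then have uB: "u \<in> B - {z}" using u by auto
    then have c: "coord B u x < coord B u y"
      using V0_swap(6)[OF y z xV uB] V1_coord[OF x(1,2) y z] u by simp
    \<comment> \<open>At such a \<open>u\<close> the vertex \<open>y\<close> would already have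
      coordinate -1, so \<open>x\<close> would be below -1 there, against
      \<open>V1_coord\<close>.\<close>
    have "u \<notin> negs y"
    proof
      assume uy: "u \<in> negs y"
      then have "coord B u x < -1" using c V0_swap(2)[OF y uy] by simp
      then have "u \<in> negs x" using uB by (auto simp: negs_def)
      then show False using V1_coord[OF x(1) _ y uy] \<open>coord B u x < -1\<close> by simp
    qed
    then have "coord B u x \<ge> 0" using x(3) uB coord_nonneg by auto
    then show "\<exists>u. u \<in> ?P \<and> u \<in> B - {z} \<and> coord ?B u x < 0" using c uB u by auto
  next
    fix x1 x2 u
    assume x: "x1 \<in> {x\<in>X y. z \<in> negs x}" "x2 \<in> {x\<in>X y. z \<in> negs x}"
      and u: "u \<in> B - {z} \<and> coord ?B u x1 < 0" "u \<in> B - {z} \<and> coord ?B u x2 < 0"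
    have l: "x \<in> V \<and> lev ?B x = 0" if "x \<in> {x\<in>X y. z \<in> negs x}" for x
      using V1_swap_level[OF _ _ y z] that V1D by (auto simp: X_def)
    show "x1 = x2"
      using level_zero_swap(3)[OF F, of u x2 x1] u l[OF x(1)] l[OF x(2)] by simp
  qed simp
  also have "\<dots> \<le> card (negs y)" by (rule card_pos_le[OF y])
  finally show ?thesis .
qed

text \<open>Level -1 is used up by the coordinate -1 at \<open>v\<close>; the others are nonnegative
  with sum 0.\<close>

lemma V1_single_neg:
  assumes x: "x \<in> V1" and v: "negs x = {v}" and y: "y \<in> V0" "v \<in> negs y"
  shows "x = - v"
proof -
  have xV: "x \<in> V" "lev B x = -1" using V1D x by auto
  have vB: "v \<in> B" using v negs_sub by blast
  have c: "coord B v x = -1" using V1_coord[OF x _ y] v by simp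
  have "(\<Sum>b\<in>B-{v}. coord B b x) = 0"
    using xV(2) c unfolding lev_def sum.remove[OF finite_simps(1) vB] by simp
  moreover have "\<And>b. b \<in> B - {v} \<Longrightarrow> coord B b x \<ge> 0" using v coord_nonneg by blast
  ultimately have z: "\<And>b. b \<in> B - {v} \<Longrightarrow> coord B b x = 0"
    using sum_nonneg_eq_0_iff[of "B - {v}" "\<lambda>b. coord B b x"] by simp
  have "x = (\<Sum>b\<in>B. coord B b x *\<^sub>R b)" using coord_sum[OF B(1)] B(5) xV by auto
  also have "\<dots> = - v" unfolding sum.remove[OF finite_simps(1) vB] using c z by simp
  finally show ?thesis .
qed

text \<open>Double counting of pairs (\<open>x\<close>, \<open>z\<close>) with \<open>z\<close> in
  \<open>negs x\<close>: each \<open>z\<close> in \<open>negs y\<close> has at most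
  \<open>card (negs y)\<close> partners. Each \<open>x\<close> has at least two such
  \<open>z\<close>, except those of the form -z, and there is at most one of these per
  \<open>z\<close>.\<close>

lemma card_X_le:
  assumes y: "y \<in> V0"
  shows "2 * card (X y) \<le> card (negs y) * card (negs y) + card (negs y)"
proof -
  let ?X1 = "{x\<in>X y. card (negs x) = 1}"
  have "card ?X1 \<le> card (negs y)"
  proof (rule card_le_if_inj_on_rel[where r = "\<lambda>x v. negs x = {v}"])
    fix x assume "x \<in> ?X1"
    then show "\<exists>v. v \<in> negs y \<and> negs x = {v}" by (auto simp: X_def card_1_singleton_iff)
  next
    fix x1 x2 v assume "x1 \<in> ?X1" "x2 \<in> ?X1" "v \<in> negs y" "negs x1 = {v}" "negs x2 = {v}"
    then show "x1 = x2" using V1_single_neg[OF _ _ y, of x1 v] V1_single_neg[OF _ _ y, of x2 v]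
      by (simp add: X_def)
  qed simp
  moreover have "(\<Sum>x\<in>X y. card (negs x)) \<le> card (negs y) * card (negs y)"
  proof -
    have "(\<Sum>x\<in>X y. card (negs x)) = (\<Sum>x\<in>X y. card {z\<in>negs y. z \<in> negs x})"
    proof (rule sum.cong)
      fix x assume "x \<in> X y"
      then have "{z\<in>negs y. z \<in> negs x} = negs x" by (auto simp: X_def)
      then show "card (negs x) = card {z\<in>negs y. z \<in> negs x}" by simp
    qed simp
    also have "\<dots> = (\<Sum>z\<in>negs y. card {x\<in>X y. z \<in> negs x})"
      by (rule sum_multicount_gen) auto
    also have "\<dots> \<le> (\<Sum>z\<in>negs y. card (negs y))"
      by (rule sum_mono) (rule card_X_through[OF y])
    finally show ?thesis by simp
  qed
  moreover have "2 * card (X y) \<le> (\<Sum>x\<in>X y. card (negs x)) + card ?X1"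
  proof -
    have "card ?X1 = (\<Sum>x\<in>X y. if card (negs x) = 1 then 1 else 0)"
      by (simp add: sum.If_cases Int_def)
    moreover have "(\<Sum>x\<in>X y. 2) \<le> (\<Sum>x\<in>X y. card (negs x) + (if card (negs x) = 1 then 1 else 0))"
    proof (rule sum_mono)
      fix x assume "x \<in> X y"
      then have "negs x \<noteq> {}" using negs_nonempty V1D by (auto simp: X_def)
      then have "card (negs x) \<noteq> 0" by simp
      then show "2 \<le> card (negs x) + (if card (negs x) = 1 then 1 else 0)" by presburger
    qed
    ultimately show ?thesis by (simp add: sum.distrib)
  qed
  ultimately show ?thesis by linarith
qed

text \<open>If v and its companion w both lie in A, then the plane of v and w contains a hexagon of vertices.\<close>

definition A where "A = {v\<in>B. - v \<in> V \<and> (\<exists>w\<in>B. w \<noteq> v \<and> w - v \<in> V)}"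

lemma finite_A [simp]: "finite A" by (simp add: A_def)

lemma coord_minus: "v \<in> B \<Longrightarrow> coord B u (- v) = (if u = v then -1 else 0)"
  using B(1) by (simp add: real_vector.representation_neg span_base coord_basis)

lemma coord_diff: "v \<in> B \<Longrightarrow> w \<in> B \<Longrightarrow> coord B u (w - v) = (if u = w then 1 else 0) - (if u = v then 1 else 0)"
  using B(1) by (simp add: real_vector.representation_diff span_base coord_basis)

lemma diff_V0:
  assumes "v \<in> B" "w \<in> B" "w \<noteq> v" "w - v \<in> V"
  shows "w - v \<in> V0" "negs (w - v) = {v}"
proof -
  have "lev B (w - v) = (\<Sum>u\<in>B. (if u = w then 1 else 0) - (if u = v then 1 else 0))"
    unfolding lev_def using coord_diff assms by (intro sum.cong) auto
  also have "\<dots> = 0" using assms by (simp add: sum_subtractf)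
  finally show "w - v \<in> V0" using assms by (simp add: V0_def)
  show "negs (w - v) = {v}" using assms by (auto simp: negs_def coord_diff)
qed

lemma minus_V1:
  assumes "v \<in> B" "- v \<in> V"
  shows "- v \<in> V1" "negs (- v) = {v}"
proof -
  have "lev B (- v) = (\<Sum>u\<in>B. if u = v then -1 else 0)"
    unfolding lev_def using coord_minus assms by (intro sum.cong) auto
  also have "\<dots> = -1" using assms by simp
  finally show "- v \<in> V1" using assms by (simp add: V1_def)
  show "negs (- v) = {v}" using assms by (auto simp: negs_def coord_minus)
qed

text \<open>The other coordinates are nonnegative integers with sum 1, so exactly one of them is
  1.\<close>

lemma V0_single_neg:
  assumes y: "y \<in> V0" and v: "negs y = {v}"
  shows "\<exists>w\<in>B. w \<noteq> v \<and> y = w - v"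
proof -
  have yV: "y \<in> V" "lev B y = 0" using V0D y by auto
  have vB: "v \<in> B" using v negs_sub by blast
  have c: "coord B v y = -1" using V0_swap(2)[OF y] v by simp
  have s: "(\<Sum>b\<in>B-{v}. coord B b y) = 1"
    using yV(2) c unfolding lev_def sum.remove[OF finite_simps(1) vB] by simp
  have nn: "\<And>b. b \<in> B - {v} \<Longrightarrow> coord B b y \<ge> 0" using v coord_nonneg by blast
  obtain w where w: "w \<in> B - {v}" "coord B w y \<noteq> 0"
    using s sum.neutral[of "B - {v}" "\<lambda>b. coord B b y"] by fastforce
  then have w1: "coord B w y \<ge> 1"
    using Ints_pos_ge_1[OF facet_coord_int[OF facet_B yV(1)]] nn[OF w(1)] by simp
  have s': "coord B w y + (\<Sum>b\<in>B-{v}-{w}. coord B b y) = 1"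
    using s sum.remove[OF _ w(1), of "\<lambda>b. coord B b y"] by simp
  have nn': "\<And>b. b \<in> B - {v} - {w} \<Longrightarrow> coord B b y \<ge> 0" using nn by blast
  then have "(\<Sum>b\<in>B-{v}-{w}. coord B b y) \<ge> 0" by (rule sum_nonneg)
  then have "(\<Sum>b\<in>B-{v}-{w}. coord B b y) = 0" "coord B w y = 1" using s' w1 by auto
  then have z: "\<And>b. b \<in> B - {v} - {w} \<Longrightarrow> coord B b y = 0"
    using sum_nonneg_eq_0_iff[of "B - {v} - {w}" "\<lambda>b. coord B b y"] nn' by simp
  have "y = (\<Sum>b\<in>B. coord B b y *\<^sub>R b)" using coord_sum[OF B(1)] B(5) yV by auto
  also have "\<dots> = - v + (\<Sum>b\<in>B-{v}. coord B b y *\<^sub>R b)"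
    unfolding sum.remove[OF finite_simps(1) vB] using c by simp
  also have "(\<Sum>b\<in>B-{v}. coord B b y *\<^sub>R b) = w + (\<Sum>b\<in>B-{v}-{w}. coord B b y *\<^sub>R b)"
    using sum.remove[OF _ w(1), of "\<lambda>b. coord B b y *\<^sub>R b"] \<open>coord B w y = 1\<close> by simp
  also have "(\<Sum>b\<in>B-{v}-{w}. coord B b y *\<^sub>R b) = 0" using z by (intro sum.neutral) simp
  finally show ?thesis using w(1) by (intro bexI[of _ w]) auto
qed

text \<open>The only candidate is -v. If it is a vertex, then \<open>y\<close> has the form w - v
  and witnesses that \<open>v\<close> is in \<open>A\<close>. Thus only elements of \<open>A\<close>
  contribute.\<close>

lemma card_X_single:
  assumes y: "y \<in> V0" and t: "card (negs y) = 1"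
  shows "card (X y) \<le> (if negs y \<subseteq> A then 1 else 0)"
proof -
  obtain v where v: "negs y = {v}" using t by (auto simp: card_1_singleton_iff)
  have sub: "X y \<subseteq> {- v}"
  proof
    fix x assume "x \<in> X y"
    then have x: "x \<in> V1" "negs x \<subseteq> {v}" using v by (auto simp: X_def)
    then have "negs x = {v}" using negs_nonempty V1D by blast
    then show "x \<in> {- v}" using V1_single_neg[OF x(1) _ y, of v] v by simp
  qed
  show ?thesis
  proof (cases "negs y \<subseteq> A")
    case True
    then show ?thesis using card_mono[OF _ sub] by simp
  next
    case False
    have "X y = {}"
    proof (rule ccontr)
      assume "X y \<noteq> {}"
      then have "- v \<in> X y" using sub by auto
      then have "- v \<in> V" using V1D by (auto simp: X_def)
      then have "v \<in> A" using V0_single_neg[OF y v] v negs_sub[of y] V0D[OF y] by (auto simp: A_def)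
      then show False using False v by simp
    qed
    then show ?thesis by simp
  qed
qed

section \<open>Most facet vertices lie in hexagonal directions\<close>

lemma lev_sum_V: "lev B (\<Sum>x\<in>V. x) = (\<Sum>x\<in>V. lev B x)"
proof -
  have "coord B b (\<Sum>x\<in>V. x) = (\<Sum>x\<in>V. coord B b x)" for b
    by (subst real_vector.representation_sum[OF B(1)]) (use B(5) in auto)
  then show ?thesis unfolding lev_def by (simp add: sum.swap[of _ V B])
qed

text \<open>With d = \<open>card B\<close> and n_i vertices at level -i, where n_2 includes
  everything lower, the nonnegative level sum gives n_1 + 2 n_2 \<le> d. Counting \<open>V\<close>
  gives n_0 + n_1 + n_2 = 2d - k. Both claims eliminate n_2 from these.\<close>

lemma card_levels:
  assumes k: "card V + k = 3 * card B" and s: "\<And>b. b \<in> B \<Longrightarrow> coord B b (\<Sum>x\<in>V. x) \<ge> 0"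
  shows "3 * card B \<le> card V1 + 2 * card V0 + 2 * k" "card B \<le> card V0 + k"
proof -
  let ?V2 = "{x\<in>V. lev B x \<le> -2}"
  have f: "finite ?V2" using finite_V by simp
  have l: "lev B x = 1 \<or> lev B x = 0 \<or> lev B x = -1 \<or> lev B x \<le> -2" if x: "x \<in> V" for x
  proof -
    obtain n where n: "lev B x = of_int n" using facet_lev_int[OF facet_B x] by (elim Ints_cases)
    then have "n \<le> 1" using lev_le_1[OF facet_B x] by simp
    then consider "n = 1" | "n = 0" | "n = -1" | "n \<le> -2" by linarith
    then show ?thesis
    proof cases
      case 4
      then have "real_of_int n \<le> real_of_int (-2)" unfolding of_int_le_iff .
      then show ?thesis using n by simp
    qed (use n in auto)
  qed
  have lB: "lev B x = 1 \<longleftrightarrow> x \<in> B" if "x \<in> V" for x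
    using lev_pos_iff[OF facet_B that] lev_basis[OF facet_B] by fastforce
  have V: "V = B \<union> (V0 \<union> (V1 \<union> ?V2))" using l lB B(3) by (auto simp: V0_def V1_def)
  have d: "B \<inter> (V0 \<union> (V1 \<union> ?V2)) = {}" "V0 \<inter> (V1 \<union> ?V2) = {}" "V1 \<inter> ?V2 = {}"
    using lev_basis[OF facet_B] by (auto simp: V0_def V1_def)
  have split: "sum h V = sum h B + (sum h V0 + (sum h V1 + sum h ?V2))" for h :: "'a \<Rightarrow> real"
    apply (subst V)
    using d f by (simp add: sum.union_disjoint)
  have "card V = card B + (card V0 + (card V1 + card ?V2))"
    using split[of "\<lambda>_. 1"] by (simp flip: of_nat_add)
  moreover have "card V1 + 2 * card ?V2 \<le> card B"
  proof -
    have "0 \<le> lev B (\<Sum>x\<in>V. x)" unfolding lev_def by (rule sum_nonneg) (rule s)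
    also have "\<dots> = (\<Sum>x\<in>V. lev B x)" by (rule lev_sum_V)
    also have "\<dots> = (\<Sum>x\<in>B. 1) + ((\<Sum>x\<in>V0. 0) + ((\<Sum>x\<in>V1. -1) + (\<Sum>x\<in>?V2. lev B x)))"
      unfolding split[of "lev B"] using lev_basis[OF facet_B]
      by (intro arg_cong2[where f = "(+)"] sum.cong) (auto simp: V0_def V1_def)
    also have "(\<Sum>x\<in>?V2. lev B x) \<le> (\<Sum>x\<in>?V2. -2)" by (rule sum_mono) auto
    finally have "real (card V1) + 2 * real (card ?V2) \<le> real (card B)" by simp
    then show ?thesis by linarith
  qed
  ultimately show "3 * card B \<le> card V1 + 2 * card V0 + 2 * k" "card B \<le> card V0 + k"
    using k by linarith+
qed

text \<open>If \<open>negs x\<close> lies in \<open>D0\<close>, then by \<open>V1_negs_same\<close>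
  it lies in a single \<open>negs y\<close>. Otherwise it has an element outside \<open>D0\<close>,
  and that element determines \<open>x\<close>.\<close>

lemma card_V1_le: "card V1 \<le> card (B - D0) + (\<Sum>y\<in>V0. card (X y))"
proof -
  let ?W = "{x\<in>V1. \<not> negs x \<subseteq> D0}"
  have "V1 \<subseteq> ?W \<union> (\<Union>y\<in>V0. X y)"
  proof
    fix x assume x: "x \<in> V1"
    show "x \<in> ?W \<union> (\<Union>y\<in>V0. X y)"
    proof (cases "negs x \<subseteq> D0")
      case True
      obtain v where v: "v \<in> negs x" using negs_nonempty V1D[OF x] by blast
      then obtain y where y: "y \<in> V0" "v \<in> negs y" using True by (auto simp: D0_def)
      have "negs x \<subseteq> negs y"
      proof
        fix u assume u: "u \<in> negs x"
        then obtain z where z: "z \<in> V0" "u \<in> negs z" using True by (auto simp: D0_def)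
        show "u \<in> negs y" using V1_negs_same[OF x v y u z] z by simp
      qed
      then show ?thesis using x y by (auto simp: X_def)
    qed (use x in simp)
  qed
  then have "card V1 \<le> card (?W \<union> (\<Union>y\<in>V0. X y))" by (rule card_mono[rotated]) simp
  also have "\<dots> \<le> card ?W + card (\<Union>y\<in>V0. X y)" by (rule card_Un_le)
  also have "card (\<Union>y\<in>V0. X y) \<le> (\<Sum>y\<in>V0. card (X y))" by (rule card_UN_le) simp
  also have "card ?W \<le> card (B - D0)"
    by (rule card_le_if_inj_on_rel[where r = "\<lambda>x z. z \<in> negs x"])
      (use V1_outside_unique negs_sub in \<open>auto, blast+\<close>)
  finally show ?thesis by simp
qed

text \<open>With d = \<open>card B\<close> and a = \<open>card A\<close>, the bounds
  \<open>card V0\<close> = \<open>card D0\<close> - r \<le> d - r and \<open>card V1\<close> \<le> d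
  - \<open>card D0\<close> + a + 2r + r^2 are put into 3d \<le> \<open>card V1\<close> + 2
  \<open>card V0\<close> + 2k. The linear terms in r cancel, leaving d - a \<le> 2k + r^2.\<close>

lemma card_outside_A_le:
  assumes k: "card V + k = 3 * card B" and s: "\<And>b. b \<in> B \<Longrightarrow> coord B b (\<Sum>x\<in>V. x) \<ge> 0"
  shows "card (B - A) \<le> 2 * k + k * k"
proof -
  define e where "e y = card (negs y) - 1" for y
  define a :: "'a \<Rightarrow> nat" where "a y = (if card (negs y) = 1 \<and> negs y \<subseteq> A then 1 else 0)" for y
  define r where "r = (\<Sum>y\<in>V0. e y)"
  have t: "card (negs y) = e y + 1" if "y \<in> V0" for y
    using negs_nonempty[of y] V0D[OF that] card_gt_0_iff[of "negs y"] by (simp add: e_def)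
  have D0: "card D0 = r + card V0"
    unfolding card_D0 r_def using t by (simp add: sum.distrib[of e "\<lambda>_. 1", simplified, symmetric])
  have X: "card (X y) \<le> a y + (2 * e y + e y * e y)" if y: "y \<in> V0" for y
  proof (cases "e y = 0")
    case True
    then show ?thesis using card_X_single[OF y] t[OF y] by (auto simp: a_def split: if_splits)
  next
    case False
    \<comment> \<open>\<open>card_X_le\<close> in terms of the excess e: (e^2 + 3e + 2) / 2 is at
      most e^2 + 2e as soon as e \<ge> 1.\<close>
    have "2 * card (X y) \<le> (e y + 1) * (e y + 1) + (e y + 1)" using card_X_le[OF y] t[OF y] by simp
    moreover have "e y * e y \<ge> e y" "e y \<ge> 1" using False by auto
    ultimately show ?thesis by (simp add: algebra_simps)
  qed
  have "(\<Sum>y\<in>V0. a y) = card {y\<in>V0. card (negs y) = 1 \<and> negs y \<subseteq> A}"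
    unfolding a_def by (simp add: sum.If_cases Int_def)
  also have "\<dots> \<le> card A"
  proof (rule card_le_if_inj_on_rel[where r = "\<lambda>y v. negs y = {v}"])
    fix y1 y2 v
    assume "y1 \<in> {y\<in>V0. card (negs y) = 1 \<and> negs y \<subseteq> A}" "y2 \<in> {y\<in>V0. card (negs y) = 1 \<and> negs y \<subseteq> A}"
      "negs y1 = {v}" "negs y2 = {v}"
    then show "y1 = y2" using V0_swap(3)[of y2 v y1] by simp
  qed (auto simp: card_1_singleton_iff)
  finally have a: "(\<Sum>y\<in>V0. a y) \<le> card A" .
  have "(\<Sum>y\<in>V0. e y * e y) \<le> (\<Sum>y\<in>V0. e y * r)"
    unfolding r_def by (intro sum_mono mult_le_mono2 member_le_sum) auto
  also have "\<dots> = r * r" by (simp add: r_def sum_distrib_right)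
  finally have ee: "(\<Sum>y\<in>V0. e y * e y) \<le> r * r" .
  have "(\<Sum>y\<in>V0. card (X y)) \<le> (\<Sum>y\<in>V0. a y + (2 * e y + e y * e y))" by (rule sum_mono) (rule X)
  also have "\<dots> = (\<Sum>y\<in>V0. a y) + (2 * r + (\<Sum>y\<in>V0. e y * e y))"
    by (simp add: sum.distrib r_def sum_distrib_left)
  also have "\<dots> \<le> card A + (2 * r + r * r)" using a ee by simp
  finally have V1: "card V1 \<le> card (B - D0) + (card A + (2 * r + r * r))" using card_V1_le by simp
  have "card (B - D0) + card D0 = card B" using card_Diff_subset[OF _ D0_sub] card_mono[OF _ D0_sub] by simp
  moreover have AB: "A \<subseteq> B" by (auto simp: A_def)
  have "card (B - A) + card A = card B" using card_Diff_subset[OF _ AB] card_mono[OF _ AB] by simp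
  moreover note card_levels[OF k s]
  \<comment> \<open>From r + \<open>card V0\<close> = \<open>card D0\<close> \<le>
    \<open>card B\<close> \<le> \<open>card V0\<close> + k.\<close>
  moreover have "r \<le> k" using calculation D0 by linarith
  then have "r * r \<le> k * k" by (intro mult_le_mono)
  ultimately show ?thesis using V1 D0 by linarith
qed

text \<open>The choice is harmless on \<open>B\<close>: w - v is at level 0 and negative at
  \<open>v\<close>, so by \<open>V0_swap\<close> there is at most one such \<open>w\<close>.\<close>

definition \<phi> where "\<phi> v = (SOME w. w \<in> B \<and> w \<noteq> v \<and> w - v \<in> V)"

lemma \<phi>: "v \<in> A \<Longrightarrow> \<phi> v \<in> B \<and> \<phi> v \<noteq> v \<and> \<phi> v - v \<in> V"
  unfolding \<phi>_def by (rule someI_ex) (auto simp: A_def)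

lemma AD: "v \<in> A \<Longrightarrow> v \<in> B \<and> - v \<in> V"
  by (auto simp: A_def)

text \<open>In the new basis -v = (w - v) - w. Thus -v is the vertex at level 0 that belongs to
  \<open>w\<close>, and uniqueness across \<open>w\<close> can be played against it.\<close>

lemma minus_after_swap:
  assumes v: "v \<in> B" "- v \<in> V" and w: "w \<in> B" "w \<noteq> v" "w - v \<in> V"
  shows "facet (insert (w - v) (B - {v}))"
    and "lev (insert (w - v) (B - {v})) (- v) = 0" "coord (insert (w - v) (B - {v})) w (- v) = -1"
    and "u \<in> B - {v} \<Longrightarrow> u \<noteq> w \<Longrightarrow> coord (insert (w - v) (B - {v})) u (- v) = 0"
proof -
  let ?C = "insert (w - v) (B - {v})"
  note D = diff_V0[OF v(1) w]
  have "v \<in> negs (w - v)" using D by simp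
  note S = V0_swap[OF D(1) this]
  show "facet ?C" by (fact S(1))
  show "lev ?C (- v) = 0" using S(4)[OF v(2)] coord_minus[OF v(1)] minus_V1[OF v] V1D by simp
  show "coord ?C w (- v) = -1" using S(6)[OF v(2), of w] w v coord_minus[OF v(1)] coord_diff[OF v(1) w(1)] by simp
  show "u \<in> B - {v} \<Longrightarrow> u \<noteq> w \<Longrightarrow> coord ?C u (- v) = 0"
    using S(6)[OF v(2), of u] w v coord_minus[OF v(1)] coord_diff[OF v(1) w(1)] by simp
qed

text \<open>If the companion \<open>u\<close> of \<open>w\<close> were not \<open>v\<close>, then u
  - w would have coordinate 0 at \<open>v\<close> and remain at level 0 after crossing
  \<open>v\<close>, with coordinate -1 at \<open>w\<close>. But -v is the only such vertex
  there.\<close>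

lemma \<phi>_involution:
  assumes v: "v \<in> A" "\<phi> v \<in> A"
  shows "\<phi> (\<phi> v) = v"
proof (rule ccontr)
  define w where "w = \<phi> v"
  define u where "u = \<phi> w"
  assume "\<phi> (\<phi> v) \<noteq> v"
  then have uv: "u \<noteq> v" by (simp add: u_def w_def)
  have w: "w \<in> B" "w \<noteq> v" "w - v \<in> V" using \<phi>[OF v(1)] by (auto simp: w_def)
  have u: "u \<in> B" "u \<noteq> w" "u - w \<in> V" using \<phi>[OF v(2)] by (auto simp: u_def w_def)
  have vB: "v \<in> B" "- v \<in> V" using AD v by auto
  note M = minus_after_swap[OF vB w]
  note D = diff_V0[OF vB(1) w]
  have "v \<in> negs (w - v)" using D by simp
  note S = V0_swap[OF D(1) this]
  have "lev (insert (w - v) (B - {v})) (u - w) = 0"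
    using S(4)[OF u(3)] coord_diff[OF w(1) u(1)] uv w V0D[OF diff_V0(1)[OF w(1) u]] by simp
  moreover have "coord (insert (w - v) (B - {v})) w (u - w) = -1"
    using S(6)[OF u(3), of w] coord_diff[OF w(1) u(1)] uv w u by simp
  ultimately have "u - w = - v"
    using level_zero_swap(3)[OF M(1) _ vB(2) M(2), of w "u - w"] M(3) w u(3) by simp
  then have "coord B v (u - w) = coord B v (- v)" by simp
  then show False using coord_diff[OF w(1) u(1)] coord_minus[OF vB(1)] uv w by simp
qed

text \<open>Two elements with the same companion \<open>w\<close> are crossed one after the other.
  In the resulting facet both of their negatives are at level 0 and negative at \<open>w\<close>, so
  they coincide.\<close>

lemma inj_on_\<phi>: "inj_on \<phi> A"
proof (rule inj_onI, rule ccontr)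
  fix v1 v2 assume v: "v1 \<in> A" "v2 \<in> A" "\<phi> v1 = \<phi> v2" and ne: "v1 \<noteq> v2"
  define w where "w = \<phi> v1"
  have w1: "w \<in> B" "w \<noteq> v1" "w - v1 \<in> V" using \<phi>[OF v(1)] by (auto simp: w_def)
  have w2: "w \<in> B" "w \<noteq> v2" "w - v2 \<in> V" using \<phi>[OF v(2)] v(3) by (auto simp: w_def)
  have B1: "v1 \<in> B" "- v1 \<in> V" and B2: "v2 \<in> B" "- v2 \<in> V" using AD v by auto
  let ?C = "insert (w - v1) (B - {v1})"
  note M = minus_after_swap[OF B1 w1]
  note D = diff_V0[OF B1(1) w1]
  have "v1 \<in> negs (w - v1)" using D by simp
  note S = V0_swap[OF D(1) this]
  \<comment> \<open>The second crossing repeats the argument over \<open>?C\<close>, where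
    \<open>v2\<close> and \<open>w\<close> are still basis vectors.\<close>
  interpret C: fano_facet N V ?C by unfold_locales (rule M(1))
  have v2C: "v2 \<in> ?C" and wC: "w \<in> ?C" using B2 w1 ne by auto
  note D2 = C.diff_V0[OF v2C wC w2(2,3)]
  have "v2 \<in> C.negs (w - v2)" using D2 by simp
  note S2 = C.V0_swap[OF D2(1) this]
  note M2 = C.minus_after_swap[OF v2C B2(2) wC w2(2,3)]
  let ?E = "insert (w - v2) (?C - {v2})"
  have wE: "w \<in> ?C - {v2}" using wC w2 by auto
  have c0: "coord ?C v2 (- v1) = 0" using M(4)[of v2] B2 ne w2 by auto
  have "lev ?E (- v1) = 0" using S2(4)[OF B1(2)] M(2) c0 by simp
  moreover have "coord ?E w (- v1) = -1" using S2(6)[OF B1(2) wE] M(3) c0 by simp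
  ultimately have "- v1 = - v2"
    using level_zero_swap(3)[OF M2(1) _ B2(2) M2(2), of w "- v1"] M2(3) wE B1(2) by simp
  then show False using ne by simp
qed

definition A2 where "A2 = {v\<in>A. \<phi> v \<in> A}"

text \<open>The elements of \<open>A\<close> lost in passing to \<open>A2\<close> have companions
  outside \<open>A\<close>, and the companion map is injective.\<close>

lemma card_outside_A2_le: "card (B - A2) \<le> 2 * card (B - A)"
proof -
  have "B - A2 = (B - A) \<union> (A - A2)" by (auto simp: A_def A2_def)
  then have "card (B - A2) \<le> card (B - A) + card (A - A2)" using card_Un_le by metis
  also have "card (A - A2) \<le> card (B - A)"
    by (rule card_inj_on_le[of \<phi>]) (use inj_on_\<phi> \<phi> in \<open>auto simp: A2_def inj_on_def\<close>)
  finally show ?thesis by simp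
qed

end

section \<open>Flipping facets through hexagons\<close>

definition hexagon :: "'a::ab_group_add \<Rightarrow> 'a \<Rightarrow> 'a set" where
  "hexagon v w = {v, w, - v, - w, w - v, v - w}"

text \<open>Serves to select one vertex from each pair of companions; the induction removes one
  orbit at a time.\<close>

lemma involution_transversal:
  assumes "finite S" "\<And>x. x \<in> S \<Longrightarrow> f x \<in> S \<and> f x \<noteq> x \<and> f (f x) = x"
  obtains T where "T \<subseteq> S" "T \<inter> f ` T = {}" "T \<union> f ` T = S"
  using assms
proof (induction "card S" arbitrary: S thesis rule: less_induct)
  case less
  show ?case
  proof (cases "S = {}")
    case True
    then show ?thesis using less.prems(1)[of "{}"] by simp
  next
    case False
    then obtain x where x: "x \<in> S" by blast
    let ?S = "S - {x, f x}"
    have "card ?S < card S" using x less.prems(2) by (intro psubset_card_mono) auto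
    moreover have "f y \<in> ?S \<and> f y \<noteq> y \<and> f (f y) = y" if "y \<in> ?S" for y
      using less.prems(3)[of y] less.prems(3)[OF x] that by auto
    ultimately obtain T where T: "T \<subseteq> ?S" "T \<inter> f ` T = {}" "T \<union> f ` T = ?S"
      using less.hyps[of ?S] less.prems(2) by blast
    have fx: "f x \<in> S" "f x \<noteq> x" "f (f x) = x" using less.prems(3)[OF x] by auto
    show ?thesis
    proof (rule less.prems(1)[of "insert x T"])
      show "insert x T \<subseteq> S" using T(1) x by auto
      have "x \<notin> f ` T" using T(3) by blast
      then show "insert x T \<inter> f ` insert x T = {}" using T(1,2) fx by auto
      show "insert x T \<union> f ` insert x T = S" using T(3) x fx by auto
    qed
  qed
qed

context fano_vertices
begin

text \<open>q - p is at level 0 with its only negative coordinate at \<open>p\<close>, so it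
  replaces \<open>p\<close>. The facet turns from the edge {p, q} of the hexagon to the next edge
  {q, q - p}.\<close>

lemma hexagon_step:
  assumes F: "facet (insert p (insert q F))" and n: "p \<notin> F" "q \<notin> F" "p \<noteq> q" and V: "q - p \<in> V"
  shows "facet (insert q (insert (q - p) F)) \<and> q \<notin> F \<and> q - p \<notin> F \<and> q \<noteq> q - p"
proof -
  let ?B = "insert p (insert q F)"
  interpret C: fano_facet N V ?B by unfold_locales (rule F)
  have D: "q - p \<in> C.V0" "C.negs (q - p) = {p}" using C.diff_V0[of p q] n V by auto
  then have p: "p \<in> C.negs (q - p)" by simp
  have "insert (q - p) (?B - {p}) = insert q (insert (q - p) F)" using n by auto
  then have "facet (insert q (insert (q - p) F))" using C.V0_swap(1)[OF D(1) p] by simp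
  moreover have "q - p \<notin> ?B" using C.V0D[OF D(1)] by blast
  ultimately show ?thesis using n by auto
qed

lemma hexagon_flip:
  assumes F: "facet F" and vw: "v \<in> F" "w \<in> F" "v \<noteq> w" and hex: "hexagon v w \<subseteq> V"
    and ab: "(\<alpha>, \<beta>) \<in> {(1, 0), (-1, 0), (0, 1), (0, -1 :: real)}"
  obtains p q where "facet (insert p (insert q (F - {v, w})))"
    "\<And>g :: 'a \<Rightarrow> real. linear g \<Longrightarrow> g v = \<alpha> \<Longrightarrow> g w = \<beta> \<Longrightarrow> g p = 1 \<and> g q = 1"
proof -
  let ?F = "F - {v, w}"
  let ?P = "\<lambda>p q. facet (insert p (insert q ?F)) \<and> p \<notin> ?F \<and> q \<notin> ?F \<and> p \<noteq> q"
  have step: "?P q (q - p)" if "?P p q" "q - p \<in> V" for p q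
    using hexagon_step[of p q ?F] that by blast
  have "insert v (insert w ?F) = F" using vw by auto
  then have 1: "?P v w" using F vw by simp
  have 2: "?P w (w - v)" by (rule step[OF 1]) (use hex in \<open>simp add: hexagon_def\<close>)
  have 3: "?P (w - v) (- v)" using step[OF 2] hex by (simp add: hexagon_def)
  have 4: "?P (- v) (- w)" using step[OF 3] hex by (simp add: hexagon_def)
  have 5: "?P (- w) (v - w)" using step[OF 4] hex by (simp add: hexagon_def)
  have e: "v - w - - w = v" by simp
  have "?P (v - w) (v - w - - w)" by (rule step[OF 5]) (use hex in \<open>simp add: hexagon_def\<close>)
  then have 6: "?P (v - w) v" unfolding e .
  consider "\<alpha> = 1 \<and> \<beta> = 0" | "\<alpha> = -1 \<and> \<beta> = 0" | "\<alpha> = 0 \<and> \<beta> = 1" | "\<alpha> = 0 \<and> \<beta> = -1"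
    using ab by auto
  then show thesis
  proof cases
    case 1 then show ?thesis using 6 by (intro that[of "v - w" v]) (auto simp: linear_diff linear_neg)
  next
    case 2 then show ?thesis using 3 by (intro that[of "w - v" "- v"]) (auto simp: linear_diff linear_neg)
  next
    case 3 then show ?thesis using 2 by (intro that[of w "w - v"]) (auto simp: linear_diff linear_neg)
  next
    case 4 then show ?thesis using 5 by (intro that[of "- w" "v - w"]) (auto simp: linear_diff linear_neg)
  qed
qed

text \<open>In the plane of each hexagon a facet can be turned to any chosen edge, independently of the
  other hexagons.\<close>

lemma hexagon_flips:
  fixes g :: "'a \<Rightarrow> real"
  assumes B: "facet B" and T: "finite S" "S \<subseteq> B" "inj_on f S" "f ` S \<subseteq> B" "S \<inter> f ` S = {}"
    and hex: "\<And>v. v \<in> S \<Longrightarrow> hexagon v (f v) \<subseteq> V"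
    and g: "linear g" "\<And>v. v \<in> S \<Longrightarrow> (g v, g (f v)) \<in> {(1, 0), (-1, 0), (0, 1), (0, -1 :: real)}"
  shows "\<exists>F. facet F \<and> B - (S \<union> f ` S) \<subseteq> F \<and> (\<forall>x\<in>F - (B - (S \<union> f ` S)). g x = 1)"
  using T hex g(2)
proof (induction S rule: finite_induct)
  case empty
  then show ?case using B by (intro exI[of _ B]) auto
next
  case (insert v S)
  have "\<exists>F. facet F \<and> B - (S \<union> f ` S) \<subseteq> F \<and> (\<forall>x\<in>F - (B - (S \<union> f ` S)). g x = 1)"
    using insert.prems by (intro insert.IH) auto
  then obtain F where F: "facet F" "B - (S \<union> f ` S) \<subseteq> F" "\<And>x. x \<in> F - (B - (S \<union> f ` S)) \<Longrightarrow> g x = 1"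
    by blast
  have fv: "f v \<notin> f ` S" using insert.prems(2) insert.hyps(2) by (auto simp: inj_on_def)
  have v: "v \<in> F" "f v \<in> F" "v \<noteq> f v" using F(2) fv insert.prems insert.hyps by auto
  obtain p q where pq: "facet (insert p (insert q (F - {v, f v})))"
    "\<And>h :: 'a \<Rightarrow> real. linear h \<Longrightarrow> h v = g v \<Longrightarrow> h (f v) = g (f v) \<Longrightarrow> h p = 1 \<and> h q = 1"
    using hexagon_flip[OF F(1) v, of "g v" "g (f v)"] insert.prems(5,6)[of v] by blast
  have g1: "g p = 1" "g q = 1" using pq(2)[OF g(1)] by auto
  let ?F = "insert p (insert q (F - {v, f v}))"
  have "B - (insert v S \<union> f ` insert v S) \<subseteq> ?F" using F(2) by auto
  moreover have "g x = 1" if "x \<in> ?F - (B - (insert v S \<union> f ` insert v S))" for x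
    using that g1 F(3)[of x] by auto
  ultimately show ?case using pq(1) by blast
qed

end

context fano_facet
begin

text \<open>Evaluating at a vertex x the flipped facet that is steepest for x in every hexagon plane.\<close>

lemma sum_coord_touch_le:
  assumes T: "T \<subseteq> B" "inj_on f T" "f ` T \<subseteq> B" "T \<inter> f ` T = {}"
    and hex: "\<And>v. v \<in> T \<Longrightarrow> hexagon v (f v) \<subseteq> V" and x: "x \<in> V"
  shows "(\<Sum>b\<in>B - (T \<union> f ` T). coord B b x) +
    real (card {v\<in>T. coord B v x \<noteq> 0 \<or> coord B (f v) x \<noteq> 0}) \<le> 1"
proof -
  let ?R = "B - (T \<union> f ` T)"
  let ?H = "{(1, 0), (-1, 0), (0, 1), (0, -1 :: real)}"
  let ?t = "\<lambda>v. if coord B v x \<noteq> 0 \<or> coord B (f v) x \<noteq> 0 then 1 else 0 :: real"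
  have finT: "finite T" using finite_subset[OF T(1)] by simp
  \<comment> \<open>The edge is chosen by the sign of a nonzero coordinate of \<open>x\<close>,
    whose integrality makes the contribution at least 1. If both coordinates are 0, any edge
    contributes 0.\<close>
  have "\<exists>\<alpha> \<beta>. (\<alpha>, \<beta>) \<in> ?H \<and> ?t v \<le> coord B v x * \<alpha> + coord B (f v) x * \<beta>" for v
  proof -
    have I: "coord B b x = 0 \<or> coord B b x \<ge> 1 \<or> coord B b x \<le> -1" for b
      using Ints_pos_ge_1[of "coord B b x"] Ints_neg_le_m1[of "coord B b x"] facet_coord_int[OF facet_B x, of b]
      by linarith
    consider "coord B v x \<ge> 1" | "coord B v x \<le> -1" | "coord B v x = 0" "coord B (f v) x \<ge> 1"
      | "coord B v x = 0" "coord B (f v) x \<le> -1" | "coord B v x = 0" "coord B (f v) x = 0"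
      using I[of v] I[of "f v"] by blast
    then show ?thesis
    proof cases
      case 1 then show ?thesis by (intro exI[of _ 1] exI[of _ 0]) auto
    next
      case 2 then show ?thesis by (intro exI[of _ "-1"] exI[of _ 0]) auto
    next
      case 3 then show ?thesis by (intro exI[of _ 0] exI[of _ 1]) auto
    next
      case 4 then show ?thesis by (intro exI[of _ 0] exI[of _ "-1"]) auto
    next
      case 5 then show ?thesis by (intro exI[of _ 1] exI[of _ 0]) auto
    qed
  qed
  then obtain \<alpha> \<beta> where ab: "\<And>v. (\<alpha> v, \<beta> v) \<in> ?H" "\<And>v. ?t v \<le> coord B v x * \<alpha> v + coord B (f v) x * \<beta> v"
    by metis
  \<comment> \<open>The values of the flipped functional on the old basis: still 1 outside the
    hexagon planes, and the chosen pair on each \<open>v\<close> and \<open>f v\<close>.\<close>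
  define h where "h b = (if b \<in> T then \<alpha> b else if b \<in> f ` T then \<beta> (inv_into T f b) else 1)" for b
  have hf: "h (f v) = \<beta> v" if "v \<in> T" for v
    using that T(2,4) by (auto simp: h_def)
  have hv: "h v = \<alpha> v" if "v \<in> T" for v using that by (simp add: h_def)
  obtain g :: "'a \<Rightarrow> real" where g: "linear g" "\<And>x. x \<in> span B \<Longrightarrow> g x = (\<Sum>b\<in>B. coord B b x * h b)"
    "\<And>b. b \<in> B \<Longrightarrow> g b = h b" by (rule coord_functional[OF B(1), of h]) blast
  have "(g v, g (f v)) \<in> ?H" if "v \<in> T" for v
    using g(3)[of v] g(3)[of "f v"] hv[OF that] hf[OF that] T(1,3) that ab(1)[of v] by auto
  from hexagon_flips[OF facet_B finT T hex g(1) this]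
  obtain F where F: "facet F" "?R \<subseteq> F" "\<forall>x\<in>F - ?R. g x = 1" by blast
  have g1: "g b = 1" if "b \<in> F" for b
  proof (cases "b \<in> ?R")
    case True
    then show ?thesis using g(3)[of b] by (simp add: h_def)
  qed (use F(3) that in blast)
  have "g x = lev F x"
    using lev_eq_linear[OF facetD(1)[OF F(1)] _ g(1) g1, of x] facetD(5)[OF F(1)] x by auto
  then have gx: "g x \<le> 1" using lev_le_1[OF F(1) x] by simp
  have xB: "x \<in> span B" using B(5) x by auto
  have "g x = (\<Sum>b\<in>?R. coord B b x * h b) + (\<Sum>b\<in>T \<union> f ` T. coord B b x * h b)"
    unfolding g(2)[OF xB] using T by (subst sum.subset_diff[of "T \<union> f ` T"]) auto
  also have "(\<Sum>b\<in>?R. coord B b x * h b) = (\<Sum>b\<in>?R. coord B b x)"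
    by (rule sum.cong) (auto simp: h_def)
  also have "(\<Sum>b\<in>T \<union> f ` T. coord B b x * h b) = (\<Sum>v\<in>T. coord B v x * \<alpha> v + coord B (f v) x * \<beta> v)"
    using T finT hv hf by (simp add: sum.union_disjoint sum.reindex sum.distrib)
  finally have "(\<Sum>b\<in>?R. coord B b x) + (\<Sum>v\<in>T. coord B v x * \<alpha> v + coord B (f v) x * \<beta> v) \<le> 1"
    using gx by simp
  moreover have "(\<Sum>v\<in>T. ?t v) \<le> (\<Sum>v\<in>T. coord B v x * \<alpha> v + coord B (f v) x * \<beta> v)"
    by (rule sum_mono) (rule ab(2))
  moreover have "(\<Sum>v\<in>T. ?t v) = real (card {v\<in>T. coord B v x \<noteq> 0 \<or> coord B (f v) x \<noteq> 0})"
    using finT by (simp add: sum.If_cases Int_def)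
  ultimately show ?thesis by simp
qed

lemma hexagon_coord:
  assumes "v \<in> B" "w \<in> B" "v \<noteq> w" "x \<in> hexagon v w"
  shows "coord B v x \<noteq> 0 \<or> coord B w x \<noteq> 0"
  using assms by (auto simp: hexagon_def coord_minus coord_diff coord_basis[OF B(1)])

lemma card_hexagon:
  assumes "v \<in> B" "w \<in> B" "v \<noteq> w"
  shows "card (hexagon v w) = 6"
proof -
  have "inj_on (\<lambda>x. (coord B v x, coord B w x)) (hexagon v w)"
    using assms by (auto simp: inj_on_def hexagon_def coord_minus coord_diff coord_basis[OF B(1)])
  then have "card (hexagon v w) = card ((\<lambda>x. (coord B v x, coord B w x)) ` hexagon v w)"
    by (simp add: card_image)
  also have "(\<lambda>x. (coord B v x, coord B w x)) ` hexagon v w = {(1,0),(0,1),(-1,0),(0,-1),(-1,1),(1,-1)}"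
    using assms by (simp add: hexagon_def coord_minus coord_diff coord_basis[OF B(1)])
  finally show ?thesis by simp
qed

text \<open>Summing \<open>sum_coord_touch_le\<close> over \<open>V\<close>, where the part outside
  the planes is nonnegative by the choice of \<open>B\<close>, gives at most \<open>card V\<close>
  touches. Each plane is touched by its own six vertices and, if outside \<open>I\<close>, by at
  least one more; so 6|T| + |T - I| \<le> 3 \<open>card B\<close> - k.\<close>

lemma untouched_hexagons:
  assumes T: "T \<subseteq> B" "inj_on f T" "f ` T \<subseteq> B" "T \<inter> f ` T = {}"
    and hex: "\<And>v. v \<in> T \<Longrightarrow> hexagon v (f v) \<subseteq> V"
    and k: "card V + k = 3 * card B" and s: "\<And>b. b \<in> B \<Longrightarrow> coord B b (\<Sum>x\<in>V. x) \<ge> 0"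
  defines "I \<equiv> {v\<in>T. \<forall>x\<in>V. x \<in> hexagon v (f v) \<or> coord B v x = 0 \<and> coord B (f v) x = 0}"
  shows "card B \<le> 2 * card I + 7 * card (B - (T \<union> f ` T))"
proof -
  let ?R = "B - (T \<union> f ` T)"
  let ?t = "\<lambda>v. {x\<in>V. coord B v x \<noteq> 0 \<or> coord B (f v) x \<noteq> 0}"
  have finT: "finite T" using finite_subset[OF T(1)] by simp
  have I: "I \<subseteq> T" "finite I" using finT by (auto simp: I_def)
  have "(\<Sum>x\<in>V. (\<Sum>b\<in>?R. coord B b x) + real (card {v\<in>T. coord B v x \<noteq> 0 \<or> coord B (f v) x \<noteq> 0})) \<le> (\<Sum>x\<in>V. 1)"
    by (rule sum_mono) (rule sum_coord_touch_le[OF T hex])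
  moreover have "(\<Sum>x\<in>V. \<Sum>b\<in>?R. coord B b x) \<ge> 0"
  proof -
    have "(\<Sum>x\<in>V. \<Sum>b\<in>?R. coord B b x) = (\<Sum>b\<in>?R. \<Sum>x\<in>V. coord B b x)" by (rule sum.swap)
    also have "\<dots> = (\<Sum>b\<in>?R. coord B b (\<Sum>x\<in>V. x))"
      by (subst real_vector.representation_sum[OF B(1)]) (use B(5) in auto)
    finally show ?thesis using s by (auto intro: sum_nonneg)
  qed
  ultimately have "(\<Sum>x\<in>V. real (card {v\<in>T. coord B v x \<noteq> 0 \<or> coord B (f v) x \<noteq> 0})) \<le> real (card V)"
    by (simp add: sum.distrib)
  then have "(\<Sum>x\<in>V. card {v\<in>T. coord B v x \<noteq> 0 \<or> coord B (f v) x \<noteq> 0}) \<le> card V"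
    unfolding of_nat_sum[symmetric] of_nat_le_iff .
  moreover have "(\<Sum>x\<in>V. card {v\<in>T. coord B v x \<noteq> 0 \<or> coord B (f v) x \<noteq> 0}) = (\<Sum>v\<in>T. card (?t v))"
    by (rule sum_multicount_gen) (use finite_V finT in auto)
  moreover have "(\<Sum>v\<in>T. 6 + (if v \<in> T - I then 1 else 0)) \<le> (\<Sum>v\<in>T. card (?t v))"
  proof (rule sum_mono)
    fix v assume v: "v \<in> T"
    then have vB: "v \<in> B" "f v \<in> B" "v \<noteq> f v" using T by auto
    have sub: "hexagon v (f v) \<subseteq> ?t v" using hex[OF v] hexagon_coord[OF vB] by auto
    have fin: "finite (?t v)" using finite_V by simp
    have c: "6 \<le> card (?t v)" using card_mono[OF fin sub] card_hexagon[OF vB] by simp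
    show "6 + (if v \<in> T - I then 1 else 0) \<le> card (?t v)"
    proof (cases "v \<in> I")
      case False
      then obtain x where "x \<in> ?t v" "x \<notin> hexagon v (f v)" using v by (auto simp: I_def)
      then have "hexagon v (f v) \<subset> ?t v" using sub by blast
      then show ?thesis using psubset_card_mono[OF fin, of "hexagon v (f v)"] card_hexagon[OF vB] by simp
    qed (use c in simp)
  qed
  moreover have "(\<Sum>v\<in>T. 6 + (if v \<in> T - I then 1 else 0)) = 6 * card T + card (T - I)"
    using finT by (simp add: sum.distrib sum.If_cases Int_def flip: set_diff_eq)
  moreover have "card (T - I) + card I = card T" using card_Diff_subset[OF I(2,1)] card_mono[OF finT I(1)] by simp
  moreover have "card B = card ?R + 2 * card T"
  proof -
    have "card (T \<union> f ` T) = 2 * card T" using T(2,4) finT by (simp add: card_Un_disjoint card_image)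
    moreover have "card (B - (T \<union> f ` T)) + card (T \<union> f ` T) = card B"
      using T card_Diff_subset[of "T \<union> f ` T" B] card_mono[of B "T \<union> f ` T"] finT by simp
    ultimately show ?thesis by simp
  qed
  ultimately show ?thesis using k by linarith
qed

end

context fano_vertices
begin

lemma hexagons_exist:
  assumes k: "card V + k = 3 * dim N"
  obtains B I f where "facet B" "I \<subseteq> B" "inj_on f I" "f ` I \<subseteq> B" "I \<inter> f ` I = {}"
    "\<And>v. v \<in> I \<Longrightarrow> hexagon v (f v) \<subseteq> V"
    "\<And>v x. v \<in> I \<Longrightarrow> x \<in> V \<Longrightarrow> x \<in> hexagon v (f v) \<or> coord B v x = 0 \<and> coord B (f v) x = 0"
    "dim N \<le> 2 * card I + (14 * k^2 + 28 * k)"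
proof -
  obtain B where fB: "facet B" and s: "\<And>b. b \<in> B \<Longrightarrow> coord B b (\<Sum>x\<in>V. x) \<ge> 0"
    using facet_max_sum by blast
  interpret fano_facet N V B by unfold_locales (rule fB)
  have cB: "card B = dim N" by (rule facetD(6)[OF fB])
  have k': "card V + k = 3 * card B" using k cB by simp
  have inv: "\<phi> v \<in> A2 \<and> \<phi> v \<noteq> v \<and> \<phi> (\<phi> v) = v" if "v \<in> A2" for v
    using that \<phi>_involution[of v] \<phi>[of v] by (auto simp: A2_def)
  have "finite A2" by (simp add: A2_def)
  then obtain T where T: "T \<subseteq> A2" "T \<inter> \<phi> ` T = {}" "T \<union> \<phi> ` T = A2"
    using involution_transversal[of A2 \<phi>] inv by blast
  have TA: "T \<subseteq> A" "T \<subseteq> B" "\<phi> ` T \<subseteq> B" "inj_on \<phi> T"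
    using T(1) AD \<phi> inj_on_\<phi> inj_on_subset[of \<phi> A T] by (auto simp: A2_def)
  have hex: "hexagon v (\<phi> v) \<subseteq> V" if "v \<in> T" for v
  proof -
    have v: "v \<in> A" "\<phi> v \<in> A" using that T(1) by (auto simp: A2_def)
    \<comment> \<open>The sixth vertex of the hexagon is supplied by the companion of the companion,
      which is \<open>v\<close> again.\<close>
    have "v - \<phi> v \<in> V" using \<phi>[OF v(2)] \<phi>_involution[OF v] by simp
    then show ?thesis using \<phi>[OF v(1)] AD[OF v(1)] AD[OF v(2)] facetD(3)[OF fB] by (auto simp: hexagon_def)
  qed
  define I where "I = {v\<in>T. \<forall>x\<in>V. x \<in> hexagon v (\<phi> v) \<or> coord B v x = 0 \<and> coord B (\<phi> v) x = 0}"
  have "card B \<le> 2 * card I + 7 * card (B - A2)"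
    using untouched_hexagons[OF TA(2) TA(4) TA(3) T(2) hex k' s] unfolding I_def T(3) .
  also have "card (B - A2) \<le> 2 * (2 * k + k * k)"
    using card_outside_A2_le card_outside_A_le[OF k' s] by simp
  finally have d: "dim N \<le> 2 * card I + (14 * k^2 + 28 * k)" by (simp add: cB power2_eq_square)
  show thesis
  proof (rule that[OF fB, of I \<phi>])
    show "I \<subseteq> B" "\<phi> ` I \<subseteq> B" "I \<inter> \<phi> ` I = {}" using TA T(2) by (auto simp: I_def)
    show "inj_on \<phi> I" using TA(4) by (rule inj_on_subset) (auto simp: I_def)
  qed (use hex d in \<open>auto simp: I_def\<close>)
qed

end

section \<open>Face fans in terms of functionals\<close>

text \<open>Every proper face is cut out by a functional bounded by 1, and the zero functional gives
  the zero cone. Describing cones by functionals makes restriction to a summand and gluing over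
  summands immediate.\<close>

definition fan_of :: "'a::euclidean_space set \<Rightarrow> 'a set set" where
  "fan_of V = {convex_cone hull {x\<in>V. g x = 1} | g :: 'a \<Rightarrow> real. linear g \<and> (\<forall>x\<in>V. g x \<le> 1)}"

lemma linear_eq_inner:
  fixes g :: "'a::euclidean_space \<Rightarrow> real"
  assumes "linear g"
  obtains a where "\<And>x. g x = a \<bullet> x"
  using adjoint_works[OF assms, of _ 1] that[of "adjoint g 1"] by (simp add: inner_commute)

lemma linear_inner: "linear (\<lambda>x. (a \<bullet> x) / b)"
  by (rule linearI) (auto simp: inner_add_right add_divide_distrib)

lemma le_on_convex_hull:
  fixes g :: "'a::euclidean_space \<Rightarrow> real"
  assumes g: "linear g" and x: "x \<in> convex hull S" and le: "\<And>y. y \<in> S \<Longrightarrow> g y \<le> c"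
  shows "g x \<le> c"
proof -
  obtain a where a: "\<And>x. g x = a \<bullet> x" using linear_eq_inner[OF g] by blast
  have "convex hull S \<subseteq> {x. a \<bullet> x \<le> c}"
    by (rule hull_minimal) (use le a in \<open>auto simp: convex_halfspace_le\<close>)
  then show ?thesis using x a by auto
qed

text \<open>The origin is added to the generators so that the hull is {0} and not empty in rank 0.
  Since \<open>g 0 = 0\<close>, it never lies on the face.\<close>

lemma functional_face:
  fixes g :: "'a::euclidean_space \<Rightarrow> real"
  assumes V: "finite V" and g: "linear g" "\<forall>x\<in>V. g x \<le> 1"
  defines "P \<equiv> convex hull (insert 0 V)"
  shows "P \<inter> {x. g x = 1} = convex hull {x\<in>V. g x = 1}"
    and "convex hull {x\<in>V. g x = 1} face_of P"
    and "convex hull {x\<in>V. g x = 1} \<noteq> P"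
proof -
  obtain a where a: "\<And>x. g x = a \<bullet> x" using linear_eq_inner[OF g(1)] by blast
  have g0: "g 0 = 0" using g(1) by (simp add: linear_0)
  have le: "g x \<le> 1" if "x \<in> P" for x
    by (rule le_on_convex_hull[OF g(1) that[unfolded P_def]]) (use g(2) g0 in auto)
  have f: "(P \<inter> {x. g x = 1}) face_of P"
    unfolding a by (rule face_of_Int_supporting_hyperplane_le) (use le a in \<open>auto simp: P_def\<close>)
  have "compact (insert 0 V)" using V by (simp add: finite_imp_compact)
  then obtain S where S: "S \<subseteq> insert 0 V" "P \<inter> {x. g x = 1} = convex hull S"
    using face_of_convex_hull_subset[of "insert 0 V" "P \<inter> {x. g x = 1}"] f unfolding P_def by blast
  have "S \<subseteq> P \<inter> {x. g x = 1}" unfolding S(2) by (rule hull_subset)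
  then have "S \<subseteq> {x\<in>V. g x = 1}" using S(1) g0 by auto
  then have 1: "P \<inter> {x. g x = 1} \<subseteq> convex hull {x\<in>V. g x = 1}" unfolding S(2) by (rule hull_mono)
  have 2: "convex hull {x\<in>V. g x = 1} \<subseteq> P \<inter> {x. g x = 1}"
  proof (rule hull_minimal)
    show "{x \<in> V. g x = 1} \<subseteq> P \<inter> {x. g x = 1}" using hull_subset[of "insert 0 V" convex] by (auto simp: P_def)
    show "convex (P \<inter> {x. g x = 1})" using f by (rule face_of_imp_convex)
  qed
  show eq: "P \<inter> {x. g x = 1} = convex hull {x\<in>V. g x = 1}" using 1 2 by (rule subset_antisym)
  then show "convex hull {x\<in>V. g x = 1} face_of P" using f by simp
  have "0 \<in> P" by (simp add: P_def hull_inc)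
  moreover have "0 \<notin> P \<inter> {x. g x = 1}" using g0 by simp
  ultimately have "P \<inter> {x. g x = 1} \<noteq> P" by metis
  then show "convex hull {x\<in>V. g x = 1} \<noteq> P" unfolding eq .
qed

text \<open>A nonempty face is exposed by some a \<bullet> x \<le> b, with b \<ge> 0 because the
  origin is in the hull. If b were 0, the positivity condition would make a vanish on
  \<open>V\<close> and the face improper; so one may divide by b.\<close>

lemma proper_face_functional:
  fixes V :: "'a::euclidean_space set"
  assumes V: "finite V" and int: "\<And>g :: 'a \<Rightarrow> real. linear g \<Longrightarrow> \<forall>x\<in>V. g x \<le> 0 \<Longrightarrow> \<forall>x\<in>V. g x = 0"
    and F: "F face_of convex hull (insert 0 V)" "F \<noteq> convex hull (insert 0 V)"
  obtains g :: "'a \<Rightarrow> real" where "linear g" "\<forall>x\<in>V. g x \<le> 1" "F = convex hull {x\<in>V. g x = 1}"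
proof (cases "F = {}")
  case True
  show thesis by (rule that[of "\<lambda>_. 0"]) (use True in \<open>auto simp: linear_zero\<close>)
next
  case False
  let ?P = "convex hull (insert 0 V)"
  have "polytope ?P" using V by (intro polytope_convex_hull) simp
  then have "F exposed_face_of ?P" using exposed_face_of_polyhedron[OF polytope_imp_polyhedron] F(1) by blast
  then obtain a b where ab: "?P \<subseteq> {x. a \<bullet> x \<le> b}" "F = ?P \<inter> {x. a \<bullet> x = b}"
    by (auto simp: exposed_face_of_def)
  have P: "insert 0 V \<subseteq> ?P" by (rule hull_subset)
  then have "0 \<in> {x. a \<bullet> x \<le> b}" using ab(1) by blast
  then have b0: "b \<ge> 0" by simp
  have lin: "linear (\<lambda>x. a \<bullet> x)" using linear_inner[of a 1] by simp
  have "b \<noteq> 0"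
  proof
    assume b: "b = 0"
    have "\<forall>x\<in>V. a \<bullet> x \<le> 0" using ab(1) P b by blast
    then have "\<forall>x\<in>V. a \<bullet> x = 0" by (rule int[OF lin])
    then have "?P \<subseteq> {x. a \<bullet> x = 0}" by (intro hull_minimal) (auto simp: convex_hyperplane)
    then have "F = ?P" using ab(2) b by blast
    then show False using F(2) by simp
  qed
  then have b: "b > 0" using b0 by simp
  define g where "g = (\<lambda>x. (a \<bullet> x) / b)"
  have g: "linear g" "\<forall>x\<in>V. g x \<le> 1"
    unfolding g_def using linear_inner ab(1) P b by (auto simp: subset_iff)
  have "F = ?P \<inter> {x. g x = 1}" unfolding ab(2) g_def using b by auto
  then have "F = convex hull {x\<in>V. g x = 1}" using functional_face(1)[OF V g] by simp
  then show thesis using that g by blast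
qed

lemma convex_cone_hull_convex_hull: "convex_cone hull (convex hull S) = convex_cone hull S"
proof (rule subset_antisym)
  have "convex hull S \<subseteq> convex_cone hull S"
    by (rule hull_minimal) (auto simp: hull_subset convex_convex_cone_hull)
  then show "convex_cone hull (convex hull S) \<subseteq> convex_cone hull S"
    by (rule hull_minimal) (rule convex_cone_convex_cone_hull)
  show "convex_cone hull S \<subseteq> convex_cone hull (convex hull S)"
    by (rule hull_mono) (rule hull_subset)
qed

lemma face_fan_eq:
  fixes V :: "'a::euclidean_space set"
  assumes V: "finite V" and int: "\<And>g :: 'a \<Rightarrow> real. linear g \<Longrightarrow> \<forall>x\<in>V. g x \<le> 0 \<Longrightarrow> \<forall>x\<in>V. g x = 0"
  shows "face_fan (convex hull (insert 0 V)) = fan_of V"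
proof (intro subset_antisym subsetI)
  fix \<sigma> assume "\<sigma> \<in> face_fan (convex hull (insert 0 V))"
  then obtain F where F: "\<sigma> = convex_cone hull F" "F face_of convex hull (insert 0 V)" "F \<noteq> convex hull (insert 0 V)"
    by (auto simp: face_fan_def)
  obtain g :: "'a \<Rightarrow> real" where g: "linear g" "\<forall>x\<in>V. g x \<le> 1" "F = convex hull {x\<in>V. g x = 1}"
    using proper_face_functional[OF V int F(2,3)] by blast
  then show "\<sigma> \<in> fan_of V" unfolding fan_of_def F(1) g(3) convex_cone_hull_convex_hull using g by blast
next
  fix \<sigma> assume "\<sigma> \<in> fan_of V"
  then obtain g :: "'a \<Rightarrow> real" where g: "linear g" "\<forall>x\<in>V. g x \<le> 1" "\<sigma> = convex_cone hull {x\<in>V. g x = 1}"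
    by (auto simp: fan_of_def)
  then show "\<sigma> \<in> face_fan (convex hull (insert 0 V))"
    unfolding face_fan_def using functional_face(2,3)[OF V g(1,2)]
    by (metis (mono_tags, lifting) convex_cone_hull_convex_hull mem_Collect_eq)
qed

lemma span_convex_cone_hull: "span (convex_cone hull S) = span S"
proof (rule subset_antisym)
  have "convex_cone (span S)" by (auto simp: convex_cone_iff span_zero intro: span_add span_scale)
  then have "convex_cone hull S \<subseteq> span S" using hull_minimal[of S "span S" convex_cone] span_superset by blast
  then show "span (convex_cone hull S) \<subseteq> span S" by (rule span_minimal) (rule subspace_span)
  show "span S \<subseteq> span (convex_cone hull S)" by (rule span_mono) (rule hull_subset)
qed

lemma dim_convex_cone_hull: "dim (convex_cone hull S) = dim S"
  using span_convex_cone_hull[of S] dim_span[of S] dim_span[of "convex_cone hull S"] by simp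

lemma convex_cone_hull_singleton: "y \<in> convex_cone hull {x} \<Longrightarrow> \<exists>c\<ge>0. y = c *\<^sub>R x"
proof -
  have "convex_cone {c *\<^sub>R x | c. c \<ge> 0}"
    unfolding convex_cone_iff
  proof (intro conjI ballI allI impI)
    show "0 \<in> {c *\<^sub>R x |c. 0 \<le> c}" by (auto intro: exI[of _ 0])
    show "u + v \<in> {c *\<^sub>R x |c. 0 \<le> c}" if "u \<in> {c *\<^sub>R x |c. 0 \<le> c}" "v \<in> {c *\<^sub>R x |c. 0 \<le> c}" for u v
      using that by (auto simp flip: scaleR_add_left intro: add_nonneg_nonneg)
    show "e *\<^sub>R u \<in> {c *\<^sub>R x |c. 0 \<le> c}" if "u \<in> {c *\<^sub>R x |c. 0 \<le> c}" "0 \<le> e" for u e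
      using that by (auto intro: mult_nonneg_nonneg)
  qed
  moreover have "{x} \<subseteq> {c *\<^sub>R x | c. c \<ge> 0}" by (auto intro: exI[of _ 1])
  ultimately have "convex_cone hull {x} \<subseteq> {c *\<^sub>R x | c. c \<ge> 0}" by (intro hull_minimal)
  then show "y \<in> convex_cone hull {x} \<Longrightarrow> \<exists>c\<ge>0. y = c *\<^sub>R x" by blast
qed

text \<open>A level-one set of dimension 1 lies on a line through the origin and is a single vertex.
  Distinct vertices span distinct rays: on a common ray each would be the other times a factor below
  1.\<close>

lemma card_rays:
  fixes V :: "'a::euclidean_space set"
  assumes V: "finite V" "0 \<notin> V"
    and vertex: "\<And>x. x \<in> V \<Longrightarrow> \<exists>g :: 'a \<Rightarrow> real. linear g \<and> (\<forall>y\<in>V. g y \<le> 1) \<and> {y\<in>V. g y = 1} = {x}"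
  shows "card {\<sigma> \<in> fan_of V. dim \<sigma> = 1} = card V"
proof -
  have "{\<sigma> \<in> fan_of V. dim \<sigma> = 1} = (\<lambda>x. convex_cone hull {x}) ` V"
  proof (intro subset_antisym subsetI)
    fix \<sigma> assume "\<sigma> \<in> {\<sigma> \<in> fan_of V. dim \<sigma> = 1}"
    then obtain g :: "'a \<Rightarrow> real" where g: "linear g" "\<sigma> = convex_cone hull {x\<in>V. g x = 1}"
      and "dim \<sigma> = 1" unfolding fan_of_def by blast
    then have d: "dim {x\<in>V. g x = 1} = 1" by (simp add: dim_convex_cone_hull)
    let ?S = "{x\<in>V. g x = 1}"
    have "?S \<noteq> {}"
    proof
      assume "?S = {}"
      then have "dim ?S = 0" by (simp only: dim_empty)
      then show False using d by simp
    qed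
    then obtain x where x: "x \<in> ?S" by blast
    then have "x \<noteq> 0" using V(2) by auto
    have "span {x} = span ?S"
      by (rule dim_eq_span) (use x d \<open>x \<noteq> 0\<close> in auto)
    have "?S \<subseteq> {x}"
    proof
      fix y assume y: "y \<in> ?S"
      then have "y \<in> span {x}" using span_base[OF y] \<open>span {x} = span ?S\<close> by simp
      then obtain c where "y = c *\<^sub>R x" by (auto simp: span_singleton)
      then show "y \<in> {x}" using x y g(1) by (simp add: linear_scale)
    qed
    then have "?S = {x}" using x by blast
    then show "\<sigma> \<in> (\<lambda>x. convex_cone hull {x}) ` V" using g(2) x by auto
  next
    fix \<sigma> assume "\<sigma> \<in> (\<lambda>x. convex_cone hull {x}) ` V"
    then obtain x where x: "x \<in> V" "\<sigma> = convex_cone hull {x}" by blast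
    obtain g :: "'a \<Rightarrow> real" where g: "linear g" "\<forall>y\<in>V. g y \<le> 1" "{y\<in>V. g y = 1} = {x}"
      using vertex[OF x(1)] by blast
    have "\<sigma> \<in> fan_of V" unfolding fan_of_def x(2) g(3)[symmetric] using g(1,2) by blast
    moreover have "x \<noteq> 0" using x(1) V(2) by auto
    then have "dim \<sigma> = 1" by (simp add: x(2) dim_convex_cone_hull)
    ultimately show "\<sigma> \<in> {\<sigma> \<in> fan_of V. dim \<sigma> = 1}" by simp
  qed
  moreover have "inj_on (\<lambda>x. convex_cone hull {x}) V"
  proof (rule inj_onI, rule ccontr)
    fix x y assume xy: "x \<in> V" "y \<in> V" "convex_cone hull {x} = convex_cone hull {y}" "x \<noteq> y"
    have key: "\<exists>c\<ge>0. c < 1 \<and> v = c *\<^sub>R u"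
      if uv: "u \<in> V" "v \<in> V" "convex_cone hull {u} = convex_cone hull {v}" "u \<noteq> v" for u v
    proof -
      obtain g :: "'a \<Rightarrow> real" where g: "linear g" "\<forall>y\<in>V. g y \<le> 1" "{y\<in>V. g y = 1} = {u}"
        using vertex[OF uv(1)] by blast
      have "v \<in> convex_cone hull {u}" unfolding uv(3) by (simp add: hull_inc)
      then obtain c where c: "c \<ge> 0" "v = c *\<^sub>R u" using convex_cone_hull_singleton by blast
      have "g u = 1" "g v \<noteq> 1" "g v \<le> 1" using g uv by auto
      then have "c < 1" using c g(1) by (simp add: linear_scale)
      then show ?thesis using c by blast
    qed
    obtain c where c: "c \<ge> 0" "c < 1" "y = c *\<^sub>R x" using key[OF xy] by blast
    obtain e where e: "e \<ge> 0" "e < 1" "x = e *\<^sub>R y" using key[of y x] xy by blast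
    have "x = (e * c) *\<^sub>R x" using c e by (metis scaleR_scaleR)
    then have "(1 - e * c) *\<^sub>R x = 0" by (simp add: scaleR_diff_left)
    moreover have "e * c < 1" using c e mult_strict_mono[of e 1 c 1] by (cases "c = 0") auto
    ultimately have "x = 0" by simp
    then show False using xy(1) V(2) by simp
  qed
  ultimately show ?thesis by (simp add: card_image)
qed

section \<open>Smooth Fano polytopes and their vertex sets\<close>

lemma zero_in_lattice: "lattice_basis N B \<Longrightarrow> 0 \<in> N"
  unfolding lattice_basis_def by (auto intro!: exI[of _ "\<lambda>_. 0"])

lemma dim_span_eq:
  fixes S T :: "'a::euclidean_space set"
  assumes "S \<subseteq> span T" "dim S = dim T"
  shows "T \<subseteq> span S"
proof -
  have "span S = span (span T)" by (rule dim_eq_span) (use assms in auto)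
  then show ?thesis using span_superset[of T] by (simp add: span_span)
qed

text \<open>The affine hull misses the origin, so adding the origin raises the affine dimension by
  one and makes it the linear dimension.\<close>

lemma aff_dim_level_one:
  fixes g :: "'a::euclidean_space \<Rightarrow> real"
  assumes g: "linear g" "\<And>x. x \<in> S \<Longrightarrow> g x = 1"
  shows "aff_dim S = int (dim S) - 1"
proof -
  obtain a where a: "\<And>x. g x = a \<bullet> x" using linear_eq_inner[OF g(1)] by blast
  have "affine hull S \<subseteq> {x. a \<bullet> x = 1}"
    by (rule hull_minimal) (use g(2) a in \<open>auto simp: affine_hyperplane\<close>)
  then have "0 \<notin> affine hull S" by auto
  then have "aff_dim (insert 0 S) = aff_dim S + 1" by (simp add: aff_dim_insert)
  moreover have "aff_dim (insert 0 S) = int (dim (insert 0 S))"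
    by (rule aff_dim_zero) (simp add: hull_inc)
  moreover have "dim (insert 0 S) = dim S" by (simp add: dim_insert span_zero)
  ultimately show ?thesis by simp
qed

text \<open>The origin is removed because in rank 0 it is itself a vertex of
  \<open>P\<close>.\<close>

lemma smooth_fano_polytope_vertices:
  assumes P: "smooth_fano_polytope N P"
  defines "V \<equiv> vert P - {0}"
  shows "P = convex hull (insert 0 V)" "fano_vertices N V"
proof -
  have lat: "\<exists>B. lattice_basis N B" and pol: "polytope P" and VN: "vert P \<subseteq> N"
    and aff: "affine hull P = span N" and ri: "0 \<in> rel_interior P"
    and fac: "\<And>F. F facet_of P \<Longrightarrow> lattice_basis N (vert F)"
    using P by (auto simp: smooth_fano_polytope_def)
  have P0: "0 \<in> P" using ri rel_interior_subset by blast
  have KM: "P = convex hull (vert P)"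
    unfolding vert_def by (rule Krein_Milman_Minkowski) (use pol in \<open>auto simp: polytope_imp_compact polytope_imp_convex\<close>)
  have ins: "insert 0 V = insert 0 (vert P)" by (auto simp: V_def)
  have "0 \<in> convex hull (vert P)" using P0 KM by simp
  then show PV: "P = convex hull (insert 0 V)" unfolding ins using KM by (simp add: hull_redundant)
  have finV: "finite V"
    using finite_polyhedron_extreme_points[OF polytope_imp_polyhedron[OF pol]] by (simp add: V_def vert_def)
  have "0 \<in> affine hull (insert 0 V)" by (simp add: hull_inc)
  then have "affine hull P = span (insert 0 V)" unfolding PV affine_hull_convex_hull by (rule affine_hull_span_0)
  then have sp: "span V = span N" using aff by simp
  have VP: "V \<subseteq> P" unfolding PV using hull_subset[of "insert 0 V" convex] by blast
  have aP: "aff_dim P = int (dim N)"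
    using aff_dim_zero[of P] P0 hull_inc[of 0 P affine] aff sp
    by (metis aff_dim_affine_hull aff_dim_subspace dim_span subspace_span)
  show "fano_vertices N V"
  proof
    show "finite V" by fact
    show "V \<subseteq> N" "0 \<notin> V" using VN by (auto simp: V_def)
    show "\<exists>B. lattice_basis N B" by fact
    show "N \<subseteq> span V" unfolding sp by (rule span_superset)
  next
    fix g :: "'a \<Rightarrow> real" assume g: "linear g" "\<forall>x\<in>V. g x \<le> 0"
    show "\<forall>x\<in>V. g x = 0"
    proof
      fix x assume x: "x \<in> V"
      have "P \<noteq> {}" using P0 by blast
      \<comment> \<open>The segment from \<open>x\<close> to the interior point 0 can be prolonged
        inside \<open>P\<close>, giving a negative multiple of \<open>x\<close> on which
        \<open>g\<close> is also at most 0.\<close>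
      then have "\<forall>x\<in>P. \<exists>e>1. (1 - e) *\<^sub>R x + e *\<^sub>R 0 \<in> P"
        using convex_rel_interior_iff[of P 0] ri polytope_imp_convex[OF pol] by blast
      then obtain e where e: "e > 1" "(1 - e) *\<^sub>R x \<in> P" using x VP by auto
      have "g ((1 - e) *\<^sub>R x) \<le> 0"
        by (rule le_on_convex_hull[OF g(1) e(2)[unfolded PV]]) (use g linear_0[OF g(1)] in auto)
      then have "(1 - e) * g x \<le> 0" using g(1) by (simp add: linear_scale)
      then have "g x \<ge> 0" using e(1) by (simp add: mult_le_0_iff)
      then show "g x = 0" using g(2) x by force
    qed
  next
    fix g :: "'a \<Rightarrow> real" assume g: "linear g" "\<forall>x\<in>V. g x \<le> 1" "V \<subseteq> span {x\<in>V. g x = 1}"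
    let ?S = "{x\<in>V. g x = 1}"
    have dS: "dim ?S = dim N"
    proof -
      have "span ?S = span V" using span_mono[of ?S V] span_minimal[OF g(3) subspace_span] by auto
      then have "dim ?S = dim V" by (metis dim_span)
      also have "\<dots> = dim N" using sp by (metis dim_span)
      finally show ?thesis .
    qed
    show "lattice_basis N ?S"
    proof (cases "?S = {}")
      \<comment> \<open>An empty level-one set can span only in rank 0. As the empty face does not
        count as a facet, the hypothesis on facets says nothing here, but the empty basis does
        it.\<close>
      case True
      obtain B where B: "lattice_basis N B" using lat by blast
      have "dim N = 0" using dS True by simp
      then have "card B = 0" using lattice_basisD(6)[OF B] by simp
      then have "B = {}" using lattice_basisD(2)[OF B] by simp
      then show ?thesis unfolding True using B by simp
    next
      case False
      note F = functional_face[OF finV g(1,2), folded PV]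
      have "aff_dim (convex hull ?S) = aff_dim P - 1"
        using aff_dim_level_one[OF g(1), of ?S] dS aP by (simp add: aff_dim_convex_hull)
      then have "convex hull ?S facet_of P" using F(2) False by (simp add: facet_of_def)
      then have "lattice_basis N (vert (convex hull ?S))" by (rule fac)
      moreover have "vert (convex hull ?S) = ?S"
      proof -
        have "vert (convex hull ?S) = vert P \<inter> (convex hull ?S)"
          unfolding vert_def using extreme_point_of_face[OF F(2)] by blast
        also have "\<dots> = {x\<in>vert P. x \<in> P \<and> g x = 1}" using F(1)[symmetric] by blast
        also have "\<dots> = ?S"
        proof -
          have "x \<in> P" if "x \<in> vert P" for x using that by (simp add: vert_def extreme_point_of_def)
          moreover have "x \<noteq> 0" if "g x = 1" for x using that linear_0[OF g(1)] by auto
          ultimately show ?thesis by (auto simp: V_def)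
        qed
        finally show ?thesis .
      qed
      ultimately show ?thesis by simp
    qed
  qed
qed

lemma fano_vertices_smooth_fano_polytope:
  assumes "fano_vertices N V"
  shows "smooth_fano_polytope N (convex hull (insert 0 V))"
proof -
  interpret fano_vertices N V by fact
  let ?P = "convex hull (insert 0 V)"
  obtain B where B: "lattice_basis N B" using lattice by blast
  have 0: "0 \<in> affine hull (insert 0 V)" by (simp add: hull_inc)
  have aff: "affine hull ?P = span N"
    unfolding affine_hull_convex_hull affine_hull_span_0[OF 0] using span_eq by simp
  have VP: "insert 0 V \<subseteq> ?P" by (rule hull_subset)
  have vert: "vert ?P \<subseteq> insert 0 V" unfolding vert_def using extreme_point_of_convex_hull by blast
  have aP: "aff_dim ?P = int (dim N)"
    using aff by (metis aff_dim_affine_hull aff_dim_subspace dim_span subspace_span)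
  have ri: "0 \<in> rel_interior ?P"
  proof (rule ccontr)
    assume n: "0 \<notin> rel_interior ?P"
    \<comment> \<open>Were 0 on the relative boundary, a supporting functional would have constant
      sign on \<open>V\<close>; by \<open>interior\<close> it vanishes there, against strictness on
      the relative interior.\<close>
    obtain a where a: "a \<noteq> 0" "\<And>y. y \<in> ?P \<Longrightarrow> a \<bullet> 0 \<le> a \<bullet> y" "\<And>y. y \<in> rel_interior ?P \<Longrightarrow> a \<bullet> 0 < a \<bullet> y"
      using supporting_hyperplane_rel_boundary[of ?P 0] n VP by (metis convex_convex_hull insert_subset)
    have lin: "linear (\<lambda>x. - a \<bullet> x)" using linear_inner[of "- a" 1] by simp
    have "\<forall>x\<in>V. - a \<bullet> x \<le> 0" using a(2) VP by fastforce
    from interior[OF lin this] have "\<forall>x\<in>V. a \<bullet> x = 0" by simp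
    then have P0: "?P \<subseteq> {x. a \<bullet> x = 0}" by (intro hull_minimal) (auto simp: convex_hyperplane)
    have "rel_interior ?P \<noteq> {}" by (simp add: rel_interior_eq_empty)
    then obtain y where y: "y \<in> rel_interior ?P" by blast
    then have "a \<bullet> y = 0" using P0 rel_interior_subset by blast
    then show False using a(3)[OF y] by simp
  qed
  have "lattice_basis N (vert F)" if F: "F facet_of ?P" for F
  proof -
    have F': "F face_of ?P" "F \<noteq> ?P" "aff_dim F = aff_dim ?P - 1" using F by (auto simp: facet_of_def)
    obtain g :: "'a \<Rightarrow> real" where g: "linear g" "\<forall>x\<in>V. g x \<le> 1" "F = convex hull {x\<in>V. g x = 1}"
      using proper_face_functional[OF finite_V interior F'(1,2)] by blast
    let ?S = "{x\<in>V. g x = 1}"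
    have "dim ?S = dim N"
      using aff_dim_level_one[OF g(1), of ?S] F'(3) aP g(3) by (simp add: aff_dim_convex_hull)
    moreover have "dim V = dim N" using span_eq by (metis dim_span)
    ultimately have "dim ?S = dim V" by simp
    then have "V \<subseteq> span ?S" by (rule dim_span_eq[rotated]) (auto intro: span_base)
    then have lb: "lattice_basis N ?S" by (rule smooth[OF g(1,2)])
    \<comment> \<open>Affine independence guarantees that no generator of the facet is lost among
      its extreme points.\<close>
    have "\<not> affine_dependent ?S" using lattice_basisD(1)[OF lb] affine_dependent_imp_dependent by blast
    then have "vert F = ?S"
      unfolding vert_def g(3) by (auto simp: extreme_point_of_convex_hull_affine_independent)
    then show ?thesis using lb by simp
  qed
  moreover have "polytope ?P" using finite_V by (intro polytope_convex_hull) simp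
  moreover have "vert ?P \<subseteq> N" using vert V_sub zero_in_lattice[OF B] by blast
  ultimately show ?thesis using B aff ri by (auto simp: smooth_fano_polytope_def)
qed

lemma picard_number_vertices:
  assumes P: "smooth_fano_polytope N P"
  shows "face_fan P = fan_of (vert P - {0})"
    and "picard_number (N, face_fan P) = int (card (vert P - {0})) - int (dim N)"
proof -
  let ?V = "vert P - {0}"
  note PV = smooth_fano_polytope_vertices(1)[OF P]
  interpret fano_vertices N ?V by (rule smooth_fano_polytope_vertices(2)[OF P])
  show fan: "face_fan P = fan_of ?V" by (rule face_fan_eq[OF finite_V interior, folded PV])
  have "card {\<sigma> \<in> fan_of ?V. dim \<sigma> = 1} = card ?V"
  proof (rule card_rays[OF finite_V zero_notin])
    fix x assume x: "x \<in> ?V"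
    then have "{x} face_of P" by (simp add: vert_def face_of_singleton)
    then have f1: "{x} face_of convex hull (insert 0 ?V)" unfolding PV[symmetric] .
    have "0 \<in> convex hull (insert 0 ?V)" by (simp add: hull_inc)
    then have f2: "{x} \<noteq> convex hull (insert 0 ?V)" using x by force
    obtain g :: "'a \<Rightarrow> real" where g: "linear g" "\<forall>x\<in>?V. g x \<le> 1" "{x} = convex hull {x\<in>?V. g x = 1}"
      using proper_face_functional[OF finite_V interior f1 f2] by blast
    have "{y\<in>?V. g y = 1} = {x}"
    proof -
      have "{y\<in>?V. g y = 1} \<subseteq> {x}" unfolding g(3) by (rule hull_subset)
      moreover have "{y\<in>?V. g y = 1} \<noteq> {}"
      proof
        assume "{y\<in>?V. g y = 1} = {}"
        then show False using g(3) by (simp only: convex_hull_empty insert_not_empty)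
      qed
      ultimately show ?thesis by blast
    qed
    with g(1,2) show "\<exists>g :: 'a \<Rightarrow> real. linear g \<and> (\<forall>y\<in>?V. g y \<le> 1) \<and> {y\<in>?V. g y = 1} = {x}"
      by (intro exI[of _ g] conjI)
  qed
  then show "picard_number (N, face_fan P) = int (card ?V) - int (dim N)"
    by (simp add: picard_number_def fan)
qed

section \<open>Splitting off hexagons\<close>

definition hex2 :: "(real \<times> real) set" where
  "hex2 = {(1, 0), (-1, 0), (0, 1), (0, -1), (1, -1), (-1, 1)}"

lemma S3_fan: "S3 = (\<int> \<times> \<int>, fan_of hex2)"
proof -
  have fin: "finite hex2" by (simp add: hex2_def)
  have int: "\<forall>x\<in>hex2. g x = 0" if g: "linear g" "\<forall>x\<in>hex2. g x \<le> 0" for g :: "real \<times> real \<Rightarrow> real"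
  proof
    fix x assume x: "x \<in> hex2"
    then have "- x \<in> hex2" by (auto simp: hex2_def)
    then have "g (- x) \<le> 0" "g x \<le> 0" using g(2) x by blast+
    then show "g x = 0" using linear_neg[OF g(1)] by simp
  qed
  \<comment> \<open>Opposite vertices average to the origin, so adding 0 to the generators does not
    change the hull.\<close>
  have "(1/2) *\<^sub>R (1, 0) + (1/2) *\<^sub>R (-1, 0) \<in> convex hull hex2"
    by (rule convexD[OF convex_convex_hull]) (auto simp: hex2_def intro: hull_inc)
  then have "0 \<in> convex hull hex2" by (simp add: zero_prod_def)
  then have "face_fan (convex hull hex2) = fan_of hex2"
    using face_fan_eq[OF fin int] by (simp add: hull_redundant)
  then show ?thesis by (simp add: S3_def hex2_def)
qed

section \<open>Cones and lattices of products\<close>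

lemma convex_cone_sum:
  assumes "convex_cone C" "\<And>i. i \<in> A \<Longrightarrow> f i \<in> C"
  shows "sum f A \<in> C"
  using assms by (induction A rule: infinite_finite_induct) (auto intro: convex_cone_contains_0 convex_cone_add)

lemma linear_axis: "linear (\<lambda>h. (axis i h, 0 :: 'b::real_vector) :: ('a::real_vector ^ 'n) \<times> 'b)"
  by (rule linearI) (auto simp: axis_def vec_eq_iff)

lemma vec_sum_axis:
  fixes y :: "'a::real_vector ^ 'n"
  assumes "\<And>i. i \<notin> J \<Longrightarrow> y $ i = 0"
  shows "y = (\<Sum>i\<in>J. axis i (y $ i))"
  unfolding vec_eq_iff
proof
  fix j
  have "(\<Sum>i\<in>J. axis i (y $ i)) $ j = (\<Sum>i\<in>J. if i = j then y $ j else 0)"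
    unfolding sum_component by (rule sum.cong) (auto simp: axis_def)
  also have "\<dots> = y $ j" using assms[of j] by simp
  finally show "y $ j = (\<Sum>i\<in>J. axis i (y $ i)) $ j" by simp
qed

text \<open>Each factor contains 0, so a point of the product is the sum of its components placed on
  the axes. The coordinates outside \<open>J\<close> are pinned to 0 as in
  \<open>toric_power\<close>.\<close>

lemma convex_cone_hull_product:
  fixes S :: "'n::finite \<Rightarrow> 'a::euclidean_space set" and T :: "'b::euclidean_space set"
  shows "convex_cone hull ((\<Union>i\<in>J. (\<lambda>h. (axis i h, 0)) ` S i) \<union> Pair 0 ` T) =
    {y. \<forall>i. y $ i \<in> (if i \<in> J then convex_cone hull S i else {0})} \<times> (convex_cone hull T)"
    (is "convex_cone hull ?U = ?Y \<times> ?T")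
proof (rule subset_antisym)
  have "convex_cone ?Y"
    unfolding convex_cone_iff[of ?Y]
    by (auto simp: convex_cone_hull_contains_0 convex_cone_hull_add convex_cone_hull_mul split: if_splits)
  then have "convex_cone (?Y \<times> ?T)" using convex_cone_convex_cone_hull by (rule convex_cone_Times)
  moreover have "?U \<subseteq> ?Y \<times> ?T"
    by (auto simp: axis_def convex_cone_hull_contains_0 hull_inc)
  ultimately show "convex_cone hull ?U \<subseteq> ?Y \<times> ?T" by (rule hull_minimal[rotated])
next
  show "?Y \<times> ?T \<subseteq> convex_cone hull ?U"
  proof
    fix p assume "p \<in> ?Y \<times> ?T"
    then obtain y z where p: "p = (y, z)" "y \<in> ?Y" "z \<in> ?T" by blast
    have "(axis i (y $ i), 0) \<in> convex_cone hull ?U" if i: "i \<in> J" for i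
    proof -
      have "y $ i \<in> convex_cone hull S i" using p(2) i by (metis (mono_tags, lifting) mem_Collect_eq)
      then have "(axis i (y $ i), 0) \<in> (\<lambda>h. (axis i h, 0)) ` (convex_cone hull S i)" by blast
      also have "\<dots> = convex_cone hull ((\<lambda>h. (axis i h, 0)) ` S i)"
        by (rule convex_cone_hull_linear_image[symmetric]) (rule linear_axis)
      also have "\<dots> \<subseteq> convex_cone hull ?U" using i by (intro hull_mono) blast
      finally show ?thesis .
    qed
    then have 1: "(\<Sum>i\<in>J. (axis i (y $ i), 0)) \<in> convex_cone hull ?U"
      by (rule convex_cone_sum[OF convex_cone_convex_cone_hull])
    let ?P = "Pair 0 :: 'b \<Rightarrow> ('a ^ 'n) \<times> 'b"
    have "linear ?P" by (rule linearI) auto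
    then have "?P ` ?T = convex_cone hull (?P ` T)" by (rule convex_cone_hull_linear_image[symmetric])
    also have "\<dots> \<subseteq> convex_cone hull ?U" by (rule hull_mono) blast
    finally have 2: "(0, z) \<in> convex_cone hull ?U" using p(3) by blast
    have y: "y = (\<Sum>i\<in>J. axis i (y $ i))"
    proof (rule vec_sum_axis)
      fix i assume "i \<notin> J"
      then show "y $ i = 0" using p(2) by (metis (mono_tags, lifting) mem_Collect_eq singletonD)
    qed
    have "p = (\<Sum>i\<in>J. (axis i (y $ i), 0)) + (0, z)"
      unfolding p(1) by (subst y) (simp add: sum_prod)
    then show "p \<in> convex_cone hull ?U" using convex_cone_hull_add[OF 1 2] by simp
  qed
qed

lemma lattice_basis_mem_iff:
  "lattice_basis N B \<Longrightarrow> x \<in> N \<longleftrightarrow> (\<exists>c :: 'a::euclidean_space \<Rightarrow> int. x = (\<Sum>b\<in>B. of_int (c b) *\<^sub>R b))"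
  by (auto simp: lattice_basis_def)

text \<open>Used for the chosen facet and again, in checking smoothness of the remaining factor, for
  every facet that completes a facet of that factor.\<close>

lemma lattice_basis_projection:
  assumes C: "lattice_basis N C" "S \<subseteq> C" and p: "linear p" "\<And>c. c \<in> C \<Longrightarrow> p c = (if c \<in> S then c else 0)"
  shows "lattice_basis (p ` N) S" "p ` N \<subseteq> N"
proof -
  have fin: "finite C" by (rule lattice_basisD(2)[OF C(1)])
  have N: "N = {(\<Sum>b\<in>C. of_int (c b) *\<^sub>R b) | c :: 'a \<Rightarrow> int. True}" using C(1) by (simp add: lattice_basis_def)
  have pc: "p (\<Sum>b\<in>C. of_int (c b) *\<^sub>R b) = (\<Sum>b\<in>S. of_int (c b) *\<^sub>R b)" for c :: "'a \<Rightarrow> int"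
  proof -
    have "p (\<Sum>b\<in>C. of_int (c b) *\<^sub>R b) = (\<Sum>b\<in>C. of_int (c b) *\<^sub>R p b)"
      using p(1) by (simp add: linear_sum linear_scale)
    also have "\<dots> = (\<Sum>b\<in>C. if b \<in> S then of_int (c b) *\<^sub>R b else 0)"
      using p(2) by (intro sum.cong) auto
    also have "\<dots> = (\<Sum>b\<in>S. of_int (c b) *\<^sub>R b)"
      using fin C(2) by (simp add: sum.If_cases Int_absorb1)
    finally show ?thesis .
  qed
  have pN: "p ` N = {(\<Sum>b\<in>S. of_int (c b) *\<^sub>R b) | c :: 'a \<Rightarrow> int. True}"
    unfolding N image_Collect using pc by (auto simp: image_iff) (metis pc)+
  moreover have "independent S" using lattice_basisD(1)[OF C(1)] C(2) by (rule independent_mono)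
  ultimately show "lattice_basis (p ` N) S" by (simp add: lattice_basis_def)
  show "p ` N \<subseteq> N"
  proof
    fix x assume "x \<in> p ` N"
    then obtain c :: "'a \<Rightarrow> int" where "x = (\<Sum>b\<in>S. of_int (c b) *\<^sub>R b)" unfolding pN by blast
    also have "\<dots> = (\<Sum>b\<in>C. of_int (if b \<in> S then c b else 0) *\<^sub>R b)"
      using fin C(2) by (simp add: if_distrib if_distribR sum.If_cases Int_absorb1 cong: if_cong)
    finally show "x \<in> N" unfolding lattice_basis_mem_iff[OF C(1)] by (rule exI[of _ "\<lambda>b. if b \<in> S then c b else 0"])
  qed
qed

lemma lattice_closed:
  assumes "lattice_basis N B"
  shows "x \<in> N \<Longrightarrow> y \<in> N \<Longrightarrow> x + y \<in> N" "x \<in> N \<Longrightarrow> n \<in> \<int> \<Longrightarrow> n *\<^sub>R x \<in> N"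
    "(\<And>i. i \<in> A \<Longrightarrow> h i \<in> N) \<Longrightarrow> sum h A \<in> N"
proof -
  note N = lattice_basis_mem_iff[OF assms]
  show add: "x + y \<in> N" if xy: "x \<in> N" "y \<in> N" for x y
  proof -
    obtain c e :: "'a \<Rightarrow> int" where "x = (\<Sum>b\<in>B. of_int (c b) *\<^sub>R b)" "y = (\<Sum>b\<in>B. of_int (e b) *\<^sub>R b)"
      using xy unfolding N by blast
    then have "x + y = (\<Sum>b\<in>B. of_int (c b + e b) *\<^sub>R b)" by (simp add: sum.distrib scaleR_add_left)
    then show ?thesis unfolding N by (rule exI[of _ "\<lambda>b. c b + e b"])
  qed
  show "n *\<^sub>R x \<in> N" if x: "x \<in> N" "n \<in> \<int>" for x n
  proof -
    obtain c :: "'a \<Rightarrow> int" where "x = (\<Sum>b\<in>B. of_int (c b) *\<^sub>R b)" using x(1) unfolding N by blast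
    moreover obtain m where "n = of_int m" using x(2) by (elim Ints_cases)
    ultimately have "n *\<^sub>R x = (\<Sum>b\<in>B. of_int (m * c b) *\<^sub>R b)" by (simp add: scaleR_sum_right)
    then show ?thesis unfolding N by (rule exI[of _ "\<lambda>b. m * c b"])
  qed
  show "(\<And>i. i \<in> A \<Longrightarrow> h i \<in> N) \<Longrightarrow> sum h A \<in> N"
    by (induction A rule: infinite_finite_induct) (auto intro: add zero_in_lattice[OF assms])
qed

section \<open>Projection away from the untouched hexagon planes\<close>

locale hexagon_splitting = fano_vertices N V for N V :: "'a::euclidean_space set" +
  fixes B :: "'a set" and J :: "'n::finite set" and v w :: "'n \<Rightarrow> 'a"
  assumes facet_B: "facet B"
    and v_B: "v ` J \<subseteq> B" "inj_on v J" and w_B: "w ` J \<subseteq> B" "inj_on w J"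
    and disjoint: "v ` J \<inter> w ` J = {}"
    and hexagon_V: "\<And>i. i \<in> J \<Longrightarrow> hexagon (v i) (w i) \<subseteq> V"
    and clean: "\<And>i x. i \<in> J \<Longrightarrow> x \<in> V \<Longrightarrow>
      x \<in> hexagon (v i) (w i) \<or> coord B (v i) x = 0 \<and> coord B (w i) x = 0"
begin

lemmas B = facetD[OF facet_B]

definition W where "W = v ` J \<union> w ` J"

definition proj :: "'a \<Rightarrow> 'a" where
  "proj = (SOME p. linear p \<and> (\<forall>b\<in>B. p b = (if b \<in> W then 0 else b)))"

text \<open>A linear extension to the whole space of the coordinate at \<open>b\<close>, because
  \<open>toric_iso\<close> asks for a linear map and \<open>coord\<close> need not be linear off
  \<open>span B\<close>.\<close>

definition coef :: "'a \<Rightarrow> 'a \<Rightarrow> real" where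
  "coef b = (SOME g. linear g \<and> (\<forall>c\<in>B. g c = (if c = b then 1 else 0)))"

lemma proj: "linear proj" "b \<in> B \<Longrightarrow> proj b = (if b \<in> W then 0 else b)"
proof -
  have "\<exists>p :: 'a \<Rightarrow> 'a. linear p \<and> (\<forall>b\<in>B. p b = (if b \<in> W then 0 else b))"
    using linear_independent_extend[OF B(1), of "\<lambda>b. if b \<in> W then 0 else b"] by blast
  from someI_ex[OF this] have "linear proj \<and> (\<forall>b\<in>B. proj b = (if b \<in> W then 0 else b))"
    unfolding proj_def .
  then show "linear proj" "b \<in> B \<Longrightarrow> proj b = (if b \<in> W then 0 else b)" by auto
qed

lemma coef: "linear (coef b)" "c \<in> B \<Longrightarrow> coef b c = (if c = b then 1 else 0)"
proof -
  have "\<exists>g :: 'a \<Rightarrow> real. linear g \<and> (\<forall>c\<in>B. g c = (if c = b then 1 else 0))"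
    using linear_independent_extend[OF B(1), of "\<lambda>c. if c = b then 1 else 0"] by blast
  from someI_ex[OF this] have "linear (coef b) \<and> (\<forall>c\<in>B. coef b c = (if c = b then 1 else 0))"
    unfolding coef_def .
  then show "linear (coef b)" "c \<in> B \<Longrightarrow> coef b c = (if c = b then 1 else 0)" by auto
qed

lemma coef_eq_coord: "b \<in> B \<Longrightarrow> x \<in> span B \<Longrightarrow> coef b x = coord B b x"
  using linear_coord[OF B(1) _ coef(1), of x b] coef(2) B(2) by (simp add: if_distrib cong: if_cong)

definition emb :: "'n \<Rightarrow> real \<times> real \<Rightarrow> 'a" where
  "emb i h = fst h *\<^sub>R v i + snd h *\<^sub>R w i"

lemma linear_emb: "linear (emb i)"
  by (rule linearI) (auto simp: emb_def algebra_simps)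

lemma hexagon_emb: "hexagon (v i) (w i) = emb i ` hex2"
  by (auto simp: hexagon_def hex2_def emb_def)

lemma vw_in: "i \<in> J \<Longrightarrow> v i \<in> B" "i \<in> J \<Longrightarrow> w i \<in> B" "i \<in> J \<Longrightarrow> v i \<in> W" "i \<in> J \<Longrightarrow> w i \<in> W"
  using v_B w_B by (auto simp: W_def)

lemma vw_eq: "i \<in> J \<Longrightarrow> j \<in> J \<Longrightarrow> v i = v j \<longleftrightarrow> i = j" "i \<in> J \<Longrightarrow> j \<in> J \<Longrightarrow> w i = w j \<longleftrightarrow> i = j"
  "i \<in> J \<Longrightarrow> j \<in> J \<Longrightarrow> v i \<noteq> w j" "i \<in> J \<Longrightarrow> j \<in> J \<Longrightarrow> w i \<noteq> v j"
  using v_B(2) w_B(2) disjoint by (auto simp: inj_on_def)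

lemma W_sub: "W \<subseteq> B" using v_B w_B by (auto simp: W_def)

lemma proj_emb: "i \<in> J \<Longrightarrow> proj (emb i h) = 0"
  using proj vw_in by (simp add: emb_def linear_add linear_scale)

lemma coef_emb: "i \<in> J \<Longrightarrow> j \<in> J \<Longrightarrow>
  coef (v j) (emb i h) = (if i = j then fst h else 0) \<and> coef (w j) (emb i h) = (if i = j then snd h else 0)"
  using coef vw_in vw_eq by (simp add: emb_def linear_add linear_scale)

lemma coef_proj:
  assumes "b \<in> W" "x \<in> span B"
  shows "coef b (proj x) = 0"
proof (rule linear_eq_0_on_span[OF _ _ assms(2)])
  show "linear (\<lambda>x. coef b (proj x))" using linear_compose[OF proj(1) coef(1)] by (simp add: o_def)
  show "coef b (proj c) = 0" if "c \<in> B" for c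
    using proj(2)[OF that] coef(2)[OF that, of b] linear_0[OF coef(1)] assms(1) by auto
qed

lemma proj_proj:
  assumes "x \<in> span B"
  shows "proj (proj x) = proj x"
proof (rule linear_eq_on_span[OF _ proj(1) _ assms])
  show "linear (\<lambda>x. proj (proj x))" using linear_compose[OF proj(1) proj(1)] by (simp add: o_def)
  show "proj (proj b) = proj b" if "b \<in> B" for b
    using proj(2)[OF that] linear_0[OF proj(1)] by auto
qed

definition N' where "N' = proj ` N"
definition V' where "V' = {x\<in>V. proj x = x}"

text \<open>By \<open>clean\<close>, a vertex in none of the hexagons has zero coordinates at all of
  \<open>W\<close>, so the projection fixes it.\<close>

lemma V_cases: "x \<in> V \<Longrightarrow> (\<exists>i\<in>J. x \<in> emb i ` hex2) \<or> x \<in> V'"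
proof (rule disjCI)
  assume x: "x \<in> V" and n: "x \<notin> V'"
  show "\<exists>i\<in>J. x \<in> emb i ` hex2"
  proof (rule ccontr)
    assume "\<not> ?thesis"
    then have c: "coord B b x = 0" if "b \<in> W" for b
      using that clean[OF _ x] unfolding W_def hexagon_emb by blast
    have xs: "x \<in> span B" using B(5) x by blast
    have "proj x = proj (\<Sum>b\<in>B. coord B b x *\<^sub>R b)" using coord_sum[OF B(1) xs] by simp
    also have "\<dots> = (\<Sum>b\<in>B. coord B b x *\<^sub>R proj b)" using proj(1) by (simp add: linear_sum linear_scale)
    also have "\<dots> = (\<Sum>b\<in>B. coord B b x *\<^sub>R b)"
      using c proj(2) by (intro sum.cong) auto
    also have "\<dots> = x" using coord_sum[OF B(1) xs] .
    finally show False using n x by (simp add: V'_def)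
  qed
qed

lemma V_split: "V = (\<Union>i\<in>J. emb i ` hex2) \<union> V'"
  using V_cases hexagon_V unfolding hexagon_emb by (auto simp: V'_def)

lemma proj_V: "x \<in> V \<Longrightarrow> proj x = 0 \<or> proj x = x"
  using V_cases[of x] proj_emb by (auto simp: V'_def)

lemma lattice_basis_N': "lattice_basis N' (B - W)" and N'_sub: "N' \<subseteq> N"
  using lattice_basis_projection[OF B(8), of "B - W" proj] proj unfolding N'_def by auto

lemma dim_N': "dim N = dim N' + 2 * card J"
proof -
  have "card W = 2 * card J"
    unfolding W_def using v_B(2) w_B(2) disjoint by (simp add: card_Un_disjoint card_image)
  moreover have "card (B - W) + card W = card B"
    using W_sub B(2) by (metis card_Diff_subset card_mono finite_subset le_add_diff_inverse2)
  ultimately show ?thesis using B(6) lattice_basisD(6)[OF lattice_basis_N'] by simp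
qed

text \<open>Functionals on the factor are pulled back along the projection, which sends every vertex
  to 0 or to itself.\<close>

lemma fano_vertices_V': "fano_vertices N' V'"
proof
  show "finite V'" using finite_V by (simp add: V'_def)
  show "V' \<subseteq> N'" using V_sub by (force simp: V'_def N'_def)
  show "0 \<notin> V'" using zero_notin by (auto simp: V'_def)
  show "\<exists>B. lattice_basis N' B" using lattice_basis_N' by blast
  show "N' \<subseteq> span V'"
  proof
    fix x assume "x \<in> N'"
    then obtain y where y: "y \<in> N" "x = proj y" by (auto simp: N'_def)
    then have "x \<in> proj ` span V" using span_V by blast
    then have "x \<in> span (proj ` V)" using linear_span_image[OF proj(1), of V] by simp
    also have "\<dots> \<subseteq> span (insert 0 V')" using proj_V by (intro span_mono) (force simp: V'_def)
    finally show "x \<in> span V'" by (simp add: span_insert_0)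
  qed
next
  fix g :: "'a \<Rightarrow> real" assume g: "linear g" "\<forall>x\<in>V'. g x \<le> 0"
  have lin: "linear (\<lambda>x. g (proj x))" using linear_compose[OF proj(1) g(1)] by (simp add: o_def)
  have "g (proj x) \<le> 0" if "x \<in> V" for x
    using proj_V[OF that] that g linear_0[OF g(1)] by (auto simp: V'_def)
  then have "\<forall>x\<in>V. g (proj x) = 0" using interior[OF lin] by blast
  then show "\<forall>x\<in>V'. g x = 0" by (auto simp: V'_def)
next
  fix g :: "'a \<Rightarrow> real" assume g: "linear g" "\<forall>x\<in>V'. g x \<le> 1" "V' \<subseteq> span {x\<in>V'. g x = 1}"
  let ?S = "{x\<in>V'. g x = 1}"
  \<comment> \<open>To test smoothness, \<open>g\<close> is completed to a functional on
    \<open>V\<close> that is 1 on the edge {v i, v i - w i} of every hexagon. Projecting the lattice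
    basis found there removes these edges and leaves \<open>?S\<close>.\<close>
  define h where "h x = g (proj x) + (\<Sum>i\<in>J. coef (v i) x)" for x
  have lin: "linear h"
    unfolding h_def
    by (rule linearI) (simp_all add: linear_add[OF proj(1)] linear_scale[OF proj(1)] linear_add[OF g(1)]
      linear_scale[OF g(1)] linear_add[OF coef(1)] linear_scale[OF coef(1)] sum.distrib sum_distrib_left algebra_simps)
  have hV': "h x = g x" if "x \<in> V'" for x
  proof -
    have "x \<in> span B" using that B(5) by (auto simp: V'_def)
    then have "coef (v i) x = 0" if "i \<in> J" for i
      using coef_proj[OF vw_in(3)[OF that]] \<open>x \<in> V'\<close> by (force simp: V'_def)
    then show ?thesis using that by (simp add: h_def V'_def)
  qed
  have hemb: "h (emb i a) = fst a" if "i \<in> J" for i a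
  proof -
    have "(\<Sum>j\<in>J. coef (v j) (emb i a)) = (\<Sum>j\<in>J. if j = i then fst a else 0)"
      using coef_emb[OF that] by (intro sum.cong) auto
    then show ?thesis using that proj_emb[OF that] linear_0[OF g(1)] by (simp add: h_def)
  qed
  have le: "\<forall>x\<in>V. h x \<le> 1"
  proof
    fix x assume "x \<in> V"
    then consider i a where "i \<in> J" "a \<in> hex2" "x = emb i a" | "x \<in> V'" using V_cases by blast
    then show "h x \<le> 1"
    proof cases
      case 1 then show ?thesis using hemb by (auto simp: hex2_def)
    next
      case 2 then show ?thesis using hV' g(2) by auto
    qed
  qed
  let ?C = "{x\<in>V. h x = 1}"
  have S: "?S \<subseteq> ?C" using hV' by (auto simp: V'_def)
  have "V \<subseteq> span ?C"
  proof
    fix x assume "x \<in> V"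
    then consider i a where "i \<in> J" "a \<in> hex2" "x = emb i a" | "x \<in> V'" using V_cases by blast
    then show "x \<in> span ?C"
    proof cases
      case 1
      \<comment> \<open>The two ends of the chosen edge span the hexagon plane.\<close>
      have "emb i (1, 0) \<in> ?C" "emb i (1, -1) \<in> ?C"
        using 1 hemb V_split by (auto simp: hex2_def)
      then have "(fst a + snd a) *\<^sub>R emb i (1, 0) - snd a *\<^sub>R emb i (1, -1) \<in> span ?C"
        by (intro span_diff span_scale span_base)
      moreover have "(fst a + snd a) *\<^sub>R emb i (1, 0) - snd a *\<^sub>R emb i (1, -1) = emb i a"
        by (simp add: emb_def algebra_simps)
      ultimately show ?thesis using 1 by simp
    next
      case 2
      then show ?thesis using g(3) span_mono[OF S] by blast
    qed
  qed
  then have C: "lattice_basis N ?C" by (rule smooth[OF lin le])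
  have "proj c = (if c \<in> ?S then c else 0)" if c: "c \<in> ?C" for c
  proof (cases "c \<in> V'")
    case True
    then show ?thesis using c hV' by (auto simp: V'_def)
  next
    case False
    then show ?thesis using c V_cases[of c] proj_emb by auto
  qed
  then show "lattice_basis N' ?S"
    unfolding N'_def by (rule lattice_basis_projection(1)[OF C S proj(1)])
qed

section \<open>The isomorphism onto the product\<close>

definition split_map :: "'a \<Rightarrow> ((real \<times> real) ^ 'n) \<times> 'a" where
  "split_map x = (\<chi> i. if i \<in> J then (coef (v i) x, coef (w i) x) else 0, proj x)"

lemma linear_split_map: "linear split_map"
proof (rule linearI)
  show "split_map (x + y) = split_map x + split_map y" for x y
    by (auto simp: split_map_def vec_eq_iff linear_add[OF coef(1)] linear_add[OF proj(1)])
  show "split_map (c *\<^sub>R x) = c *\<^sub>R split_map x" for c x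
    by (auto simp: split_map_def vec_eq_iff linear_scale[OF coef(1)] linear_scale[OF proj(1)])
qed

lemma split_map_emb: "i \<in> J \<Longrightarrow> split_map (emb i h) = (axis i h, 0)"
  using coef_emb[of i _ h] proj_emb[of i h] by (auto simp: split_map_def vec_eq_iff axis_def zero_prod_def)

lemma split_map_proj: "x \<in> span B \<Longrightarrow> split_map (proj x) = (0, proj x)"
  using coef_proj[OF vw_in(3), of _ x] coef_proj[OF vw_in(4), of _ x] proj_proj[of x]
  by (auto simp: split_map_def vec_eq_iff zero_prod_def)

lemma split_map_V': "x \<in> V' \<Longrightarrow> split_map x = (0, x)"
  using split_map_proj[of x] B(5) by (auto simp: V'_def)

text \<open>Recovers \<open>x\<close> from the components of \<open>split_map x\<close>; injectivity
  follows. Checked on the basis \<open>B\<close>.\<close>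

lemma decomposition:
  assumes "x \<in> span B"
  shows "(\<Sum>i\<in>J. emb i (coef (v i) x, coef (w i) x)) + proj x = x"
proof (rule linear_eq_on_span[of "\<lambda>x. (\<Sum>i\<in>J. emb i (coef (v i) x, coef (w i) x)) + proj x" "\<lambda>x. x" B x])
  show "linear (\<lambda>x. (\<Sum>i\<in>J. emb i (coef (v i) x, coef (w i) x)) + proj x)"
    by (rule linearI) (simp_all add: emb_def linear_add[OF coef(1)] linear_add[OF proj(1)] linear_scale[OF coef(1)]
      linear_scale[OF proj(1)] scaleR_add_left scaleR_add_right scaleR_sum_right sum.distrib)
  show "linear (\<lambda>x::'a. x)" by (rule linear_ident)
  fix b assume b: "b \<in> B"
  show "(\<Sum>i\<in>J. emb i (coef (v i) b, coef (w i) b)) + proj b = b"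
  proof (cases "b \<in> W")
    case False
    then have "emb i (coef (v i) b, coef (w i) b) = 0" if "i \<in> J" for i
      using coef(2)[OF b] vw_in[OF that] by (auto simp: emb_def)
    then show ?thesis using False proj(2)[OF b] by simp
  next
    case True
    then obtain j where j: "j \<in> J" "b = v j \<or> b = w j" by (auto simp: W_def)
    have "(\<Sum>i\<in>J. emb i (coef (v i) b, coef (w i) b)) = (\<Sum>i\<in>J. if i = j then b else 0)"
    proof (rule sum.cong)
      fix i assume i: "i \<in> J"
      show "emb i (coef (v i) b, coef (w i) b) = (if i = j then b else 0)"
        using j(2) coef(2)[OF b] vw_eq[OF i j(1)] vw_eq[OF j(1) i] by (auto simp: emb_def)
    qed simp
    then show ?thesis using True proj(2)[OF b] j(1) by simp
  qed
qed (rule assms)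

lemma inj_on_split_map: "inj_on split_map (span N)"
proof (rule inj_onI)
  fix x y assume xy: "x \<in> span N" "y \<in> span N" "split_map x = split_map y"
  have sp: "x \<in> span B" "y \<in> span B" using xy lattice_basisD(5)[OF B(8)] by auto
  have c: "coef (v i) x = coef (v i) y \<and> coef (w i) x = coef (w i) y" if "i \<in> J" for i
    using arg_cong[OF xy(3), of "\<lambda>p. fst p $ i"] that by (simp add: split_map_def)
  have p: "proj x = proj y" using xy(3) by (simp add: split_map_def)
  have "x = (\<Sum>i\<in>J. emb i (coef (v i) x, coef (w i) x)) + proj x" using decomposition[OF sp(1)] by simp
  also have "\<dots> = (\<Sum>i\<in>J. emb i (coef (v i) y, coef (w i) y)) + proj y" using c p by simp
  also have "\<dots> = y" using decomposition[OF sp(2)] by simp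
  finally show "x = y" .
qed

lemma split_map_sum_emb:
  assumes "\<And>i. i \<notin> J \<Longrightarrow> y $ i = 0" "u \<in> span B"
  shows "split_map ((\<Sum>i\<in>J. emb i (y $ i)) + proj u) = (y, proj u)"
proof -
  have "split_map ((\<Sum>i\<in>J. emb i (y $ i)) + proj u) = (\<Sum>i\<in>J. (axis i (y $ i), 0)) + (0, proj u)"
    using split_map_emb split_map_proj[OF assms(2)] by (simp add: linear_add[OF linear_split_map] linear_sum[OF linear_split_map])
  also have "\<dots> = (y, proj u)" using vec_sum_axis[of J y] assms(1) by (simp add: sum_prod)
  finally show ?thesis .
qed

lemma split_map_image_lattice: "split_map ` N = {y. \<forall>i. y $ i \<in> (if i \<in> J then \<int> \<times> \<int> else {0})} \<times> N'"
proof (intro subset_antisym subsetI)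
  fix p assume "p \<in> split_map ` N"
  then obtain x where x: "x \<in> N" "p = split_map x" by blast
  have "coef b x \<in> \<int>" if "b \<in> B" for b
    using coef_eq_coord[OF that, of x] coord_int[OF B(8) x(1)] x(1) B(4) by auto
  then show "p \<in> {y. \<forall>i. y $ i \<in> (if i \<in> J then \<int> \<times> \<int> else {0})} \<times> N'"
    using x vw_in by (auto simp: split_map_def N'_def)
next
  fix p :: "((real \<times> real) ^ 'n) \<times> 'a"
  assume "p \<in> {y. \<forall>i. y $ i \<in> (if i \<in> J then \<int> \<times> \<int> else {0})} \<times> N'"
  then obtain y u where p: "p = (y, proj u)" "u \<in> N" and y: "\<And>i. y $ i \<in> (if i \<in> J then \<int> \<times> \<int> else {0})"
    by (auto simp: N'_def)
  have "v i \<in> N" "w i \<in> N" if "i \<in> J" for i using vw_in[OF that] B(3) V_sub by blast+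
  moreover have "fst (y $ i) \<in> \<int>" "snd (y $ i) \<in> \<int>" if "i \<in> J" for i
    using y[of i] that by (auto simp: mem_Times_iff)
  ultimately have "(\<Sum>i\<in>J. emb i (y $ i)) \<in> N"
    unfolding emb_def by (intro lattice_closed(3)[OF B(8)] lattice_closed(1)[OF B(8)] lattice_closed(2)[OF B(8)])
  then have "(\<Sum>i\<in>J. emb i (y $ i)) + proj u \<in> N"
    using N'_sub p(2) by (intro lattice_closed(1)[OF B(8)]) (auto simp: N'_def)
  moreover have "y $ i = 0" if "i \<notin> J" for i using y[of i] that by simp
  then have "split_map ((\<Sum>i\<in>J. emb i (y $ i)) + proj u) = p"
    using split_map_sum_emb[of y u] p B(4) by auto
  ultimately show "p \<in> split_map ` N" by blast
qed

text \<open>Each vertex lies in a single hexagon plane or in \<open>V'\<close>, so a level-one set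
  is a union of level-one sets of the summands.\<close>

lemma split_map_image_cone:
  fixes g :: "'a \<Rightarrow> real"
  shows "split_map ` (convex_cone hull {x\<in>V. g x = 1}) =
    {y. \<forall>i. y $ i \<in> (if i \<in> J then convex_cone hull {h\<in>hex2. g (emb i h) = 1} else {0})} \<times>
      (convex_cone hull {x\<in>V'. g x = 1})"
proof -
  have "{x\<in>V. g x = 1} = (\<Union>i\<in>J. emb i ` {h\<in>hex2. g (emb i h) = 1}) \<union> {x\<in>V'. g x = 1}"
    by (subst V_split) auto
  then have "split_map ` {x\<in>V. g x = 1} =
      (\<Union>i\<in>J. (\<lambda>h. split_map (emb i h)) ` {h\<in>hex2. g (emb i h) = 1}) \<union> split_map ` {x\<in>V'. g x = 1}"
    by (simp add: image_Un image_UN image_image)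
  also have "\<dots> = (\<Union>i\<in>J. (\<lambda>h. (axis i h, 0)) ` {h\<in>hex2. g (emb i h) = 1}) \<union> Pair 0 ` {x\<in>V'. g x = 1}"
    using split_map_emb split_map_V' by (intro arg_cong2[where f = "(\<union>)"] SUP_cong image_cong) auto
  finally show ?thesis
    unfolding convex_cone_hull_linear_image[OF linear_split_map, symmetric] by (simp only: convex_cone_hull_product)
qed

text \<open>One inclusion restricts a functional to the summands, the other adds up functionals
  given on them.\<close>

lemma split_map_image_fan:
  "(`) split_map ` fan_of V = {\<sigma> \<times> \<tau> | \<sigma> \<tau>. \<sigma> \<in> snd (toric_power J S3) \<and> \<tau> \<in> fan_of V'}" (is "_ = ?R")
proof (intro subset_antisym subsetI)
  fix \<rho> assume "\<rho> \<in> (`) split_map ` fan_of V"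
  then obtain g :: "'a \<Rightarrow> real" where g: "linear g" "\<forall>x\<in>V. g x \<le> 1"
    and \<rho>: "\<rho> = split_map ` (convex_cone hull {x\<in>V. g x = 1})" by (auto simp: fan_of_def)
  have "linear (\<lambda>h. g (emb i h))" for i using linear_compose[OF linear_emb g(1)] by (simp add: o_def)
  moreover have "\<forall>h\<in>hex2. g (emb i h) \<le> 1" if "i \<in> J" for i using g(2) V_split that by blast
  ultimately have f: "convex_cone hull {h\<in>hex2. g (emb i h) = 1} \<in> fan_of hex2" if "i \<in> J" for i
    using that unfolding fan_of_def mem_Collect_eq
    by (intro exI[of _ "\<lambda>h. g (emb i h)"]) simp
  have "{y. \<forall>i. y $ i \<in> (if i \<in> J then convex_cone hull {h\<in>hex2. g (emb i h) = 1} else {0})} \<in> snd (toric_power J S3)"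
    unfolding toric_power_def S3_fan snd_conv mem_Collect_eq
    by (rule exI[of _ "\<lambda>i. convex_cone hull {h\<in>hex2. g (emb i h) = 1}"]) (simp add: f)
  moreover have "convex_cone hull {x\<in>V'. g x = 1} \<in> fan_of V'"
    unfolding fan_of_def using g by (auto simp: V'_def)
  ultimately show "\<rho> \<in> ?R" unfolding \<rho> split_map_image_cone by blast
next
  fix \<rho> assume "\<rho> \<in> ?R"
  then obtain \<sigma> \<tau> where \<rho>: "\<rho> = {y. \<forall>i. y $ i \<in> (if i \<in> J then \<sigma> i else {0})} \<times> \<tau>"
    and \<sigma>: "\<forall>i\<in>J. \<sigma> i \<in> fan_of hex2" and \<tau>: "\<tau> \<in> fan_of V'"
    by (auto simp: toric_power_def S3_fan)
  have "\<forall>i\<in>J. \<exists>g :: real \<times> real \<Rightarrow> real. linear g \<and> (\<forall>x\<in>hex2. g x \<le> 1) \<and> \<sigma> i = convex_cone hull {x\<in>hex2. g x = 1}"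
    using \<sigma> by (auto simp: fan_of_def)
  from bchoice[OF this] obtain G :: "'n \<Rightarrow> real \<times> real \<Rightarrow> real" where
    "\<forall>i\<in>J. linear (G i) \<and> (\<forall>x\<in>hex2. G i x \<le> 1) \<and> \<sigma> i = convex_cone hull {x\<in>hex2. G i x = 1}" ..
  then have G: "\<And>i. i \<in> J \<Longrightarrow> linear (G i)" "\<And>i x. i \<in> J \<Longrightarrow> x \<in> hex2 \<Longrightarrow> G i x \<le> 1"
      "\<And>i. i \<in> J \<Longrightarrow> \<sigma> i = convex_cone hull {x\<in>hex2. G i x = 1}"
    by blast+
  obtain g' :: "'a \<Rightarrow> real" where g': "linear g'" "\<forall>x\<in>V'. g' x \<le> 1" "\<tau> = convex_cone hull {x\<in>V'. g' x = 1}"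
    using \<tau> by (auto simp: fan_of_def)
  \<comment> \<open>The sum stays bounded by 1 on \<open>V\<close>, because only one of its terms is
    nonzero at a vertex that lies in a single summand.\<close>
  define g where "g x = (\<Sum>i\<in>J. G i (fst (split_map x) $ i)) + g' (snd (split_map x))" for x
  have lin: "linear g"
    unfolding g_def
    by (rule linearI) (simp_all add: linear_add[OF linear_split_map] linear_scale[OF linear_split_map] linear_add[OF G(1)]
      linear_scale[OF G(1)] linear_add[OF g'(1)] linear_scale[OF g'(1)] sum.distrib sum_distrib_left algebra_simps)
  have gemb: "g (emb i h) = G i h" if i: "i \<in> J" for i h
  proof -
    have "(\<Sum>j\<in>J. G j (axis i h $ j)) = (\<Sum>j\<in>J. if j = i then G i h else 0)"
      using linear_0[OF G(1)] by (intro sum.cong) (auto simp: axis_def)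
    then show ?thesis using i split_map_emb[OF i] linear_0[OF g'(1)] by (simp add: g_def)
  qed
  have gV': "g x = g' x" if "x \<in> V'" for x
    using split_map_V'[OF that] linear_0[OF G(1)] by (simp add: g_def)
  have "g x \<le> 1" if x: "x \<in> V" for x
  proof -
    consider i a where "i \<in> J" "a \<in> hex2" "x = emb i a" | "x \<in> V'" using V_cases[OF x] by blast
    then show ?thesis
    proof cases
      case 1 then show ?thesis using gemb G(2) by simp
    next
      case 2 then show ?thesis using gV' g'(2) by simp
    qed
  qed
  then have f: "convex_cone hull {x\<in>V. g x = 1} \<in> fan_of V" unfolding fan_of_def using lin by blast
  have "{x\<in>V'. g x = 1} = {x\<in>V'. g' x = 1}" using gV' by auto
  moreover have "(if i \<in> J then convex_cone hull {h\<in>hex2. g (emb i h) = 1} else {0}) = (if i \<in> J then \<sigma> i else {0})" for i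
    using G(3) gemb by simp
  ultimately have "split_map ` (convex_cone hull {x\<in>V. g x = 1}) = \<rho>"
    unfolding \<rho> g'(3) split_map_image_cone by simp
  then show "\<rho> \<in> (`) split_map ` fan_of V" using f by blast
qed

lemma toric_iso_splitting: "toric_iso (N, fan_of V) (toric_prod (toric_power J S3) (N', fan_of V'))"
proof -
  have "fst (toric_power J S3) = {y. \<forall>i. y $ i \<in> (if i \<in> J then \<int> \<times> \<int> else {0})}"
    by (simp add: toric_power_def S3_def)
  then show ?thesis
    unfolding toric_iso_def toric_prod_def fst_conv snd_conv
    using linear_split_map inj_on_split_map split_map_image_lattice split_map_image_fan by (intro exI[of _ split_map]) simp
qed

end

lemma toric_fano_vertices:
  assumes "fano_vertices N V"
  shows "toric_fano (dim N) (N, fan_of V)"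
proof -
  interpret fano_vertices N V by fact
  show ?thesis
    using fano_vertices_smooth_fano_polytope[OF assms] face_fan_eq[OF finite_V interior]
    by (auto simp: toric_fano_def)
qed

theorem theorem8:
  fixes X :: "(real ^ 'n) toric" and d k :: nat
  assumes "toric_fano d X"
    and "picard_number X = 2 * int d - int k"
    and "d > 15 * k^2 + 37 * k + 1"
  shows "\<exists>m e (J :: 'n set) (Y :: (real ^ 'n) toric).
           m > 0 \<and> card J = m \<and>
           toric_fano e Y \<and> e \<le> 15 * k^2 + 37 * k + 1 \<and>
           toric_iso X (toric_prod (toric_power J S3) Y)"
proof -
  obtain N P where X: "X = (N, face_fan P)" "dim N = d" and P: "smooth_fano_polytope N P"
    using assms(1) by (cases X) (auto simp: toric_fano_def)
  define V where "V = vert P - {0}"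
  interpret fano_vertices N V unfolding V_def by (rule smooth_fano_polytope_vertices(2)[OF P])
  \<comment> \<open>The rays are the cones over the vertices, so the number of vertices is the
    Picard number plus d.\<close>
  have "int (card V) + int k = 3 * int d"
    using picard_number_vertices(2)[OF P] assms(2) X by (simp add: V_def)
  then have "card V + k = 3 * dim N" unfolding X(2) by linarith
  from hexagons_exist[OF this] obtain B I f where B: "facet B" and I: "I \<subseteq> B" "inj_on f I" "f ` I \<subseteq> B" "I \<inter> f ` I = {}"
    and hex: "\<And>v. v \<in> I \<Longrightarrow> hexagon v (f v) \<subseteq> V"
    and clean: "\<And>v x. v \<in> I \<Longrightarrow> x \<in> V \<Longrightarrow> x \<in> hexagon v (f v) \<or> coord B v x = 0 \<and> coord B (f v) x = 0"
    and le: "dim N \<le> 2 * card I + (14 * k^2 + 28 * k)" by blast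
  \<comment> \<open>The exponent of S_3 has to be the size of a set of coordinates; there are enough
    of them since |I| \<le> d \<le> \<open>CARD('n)\<close>.\<close>
  have "card I \<le> dim N" using card_mono[OF facetD(2)[OF B] I(1)] facetD(6)[OF B] by simp
  also have "\<dots> \<le> CARD('n)" using dim_subset_UNIV[of N] by simp
  finally obtain J :: "'n set" where J: "card J = card I"
    using obtain_subset_with_card_n[of "card I" "UNIV :: 'n set"] by metis
  then obtain j where j: "bij_betw j J I"
    using finite_same_card_bij[of J I] finite_subset[OF I(1) facetD(2)[OF B]] by auto
  then have jJ: "j ` J = I" "inj_on j J" by (auto simp: bij_betw_def)
  interpret hexagon_splitting N V B J j "\<lambda>i. f (j i)"
  proof
    show "facet B" by (fact B)
    show "j ` J \<subseteq> B" "inj_on j J" using jJ I by auto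
    show "(\<lambda>i. f (j i)) ` J \<subseteq> B" "j ` J \<inter> (\<lambda>i. f (j i)) ` J = {}" using jJ I by auto
    show "inj_on (\<lambda>i. f (j i)) J" using comp_inj_on[OF jJ(2), of f] jJ(1) I(2) by (simp add: o_def)
    show "hexagon (j i) (f (j i)) \<subseteq> V" if "i \<in> J" for i using hex jJ(1) that by blast
    show "x \<in> hexagon (j i) (f (j i)) \<or> coord B (j i) x = 0 \<and> coord B (f (j i)) x = 0"
      if "i \<in> J" "x \<in> V" for i x using clean jJ(1) that by blast
  qed
  \<comment> \<open>The remaining dimension d - 2|I| is at most 14k^2 + 28k. As d exceeds the larger
    bound, |I| cannot be 0.\<close>
  have "14 * k^2 + 28 * k \<le> 15 * k^2 + 37 * k + 1" by simp
  moreover have "dim N = dim N' + 2 * card I" using dim_N' J by simp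
  ultimately have "card I > 0" "dim N' \<le> 15 * k^2 + 37 * k + 1" using le assms(3) X(2) by linarith+
  moreover have "toric_iso X (toric_prod (toric_power J S3) (N', fan_of V'))"
    using toric_iso_splitting picard_number_vertices(1)[OF P] by (simp add: X V_def)
  ultimately show ?thesis using J toric_fano_vertices[OF fano_vertices_V'] by blast
qed

end
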